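(* Fix $0<\beta\le\beta_c$ (so $(\beta,K(\beta))$ is a second-order point if $\beta<\beta_c$ and the tricritical point if $\beta=\beta_c$). For each $\alpha>0$ let $(\beta_n,K_n)=(\beta_n^{(\alpha)},K_n^{(\alpha)})$, $n\in\mathbb N$, be a sequence of pairs of positive numbers converging to $(\beta,K(\beta))$. Assume the following. (i) $(\beta_n,K_n)$ lies in the phase-coexistence region for all sufficiently large $n$. (ii) The limits $b=\lim_{n\to\infty}n^{\alpha}(\beta_n-\beta)$ and $k=\lim_{n\to\infty}n^{\alpha}(K_n-K(\beta))$ both exist and are not both $0$; if $b\neq0$, then $b\in\{1,-1\}$. (iii) There exist an even polynomial $g$ of degree $4$ or $6$ with $g(x)\to\infty$ as $|x|\to\infty$, and numbers $\alpha_0>0$ and $\theta>0$, such that: (a) for all $\alpha>\alpha_0$, $\lim_{n\to\infty}n^{\alpha/\alpha_0}G_{\beta_n,K_n}(x/n^{\theta\alpha})=g(x)$ uniformly for $x$ in compact subsets of $\mathbb R$; (b) $g$ has a unique positive global minimum point $\bar x$ (thus the set of global minimum points of $g$ equals $\{\pm\bar x\}$ or $\{0,\pm\bar x\}$). (iv) There exists a polynomial $H$ with $H(x)\to\infty$ as $|x|\to\infty$ such that for all $\alpha\ge\alpha_0$ there exists $R>0$ such that for all sufficiently large $n\in\mathbb N$ and all $x\in\mathbb R$ with $|x/n^{\theta\alpha}|<R$, one has $n^{\alpha/\alpha_0}G_{\beta_n,K_n}(x/n^{\theta\alpha})\ge H(x)$. (v) There exists an even polynomial $\tilde g$ of degree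 $4$ or $6$ with $\tilde g(x)\to\infty$ as $|x|\to\infty$ such that, with the same $\alpha_0$ and $\theta$, for all $\alpha>\alpha_0$ and all $x\in\mathbb R$, $\lim_{n\to\infty}nG_{\beta_n,K_n}(x/n^{\theta\alpha_0})=\tilde g(x)$. Assume also that $0<\theta\alpha_0<1/2$. Then: (a) Defining $$\bar y=\frac{1}{\int_{\mathbb R}\exp[-\tilde g(x)]\,dx}\cdot\int_{\mathbb R}|x|\exp[-\tilde g(x)]\,dx,$$ for all $\alpha>\alpha_0$ one has $E_{n,\beta_n,K_n}\{|S_n/n|\}\sim\bar y/n^{\theta\alpha_0}$, that is, $\lim_{n\to\infty}n^{\theta\alpha_0}E_{n,\beta_n,K_n}\{|S_n/n|\}=\bar y$. (b) For all $\alpha>\alpha_0$, $E_{n,\beta_n,K_n}\{|S_n/n|\}\gg m(\beta_n,K_n)$.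
   Context: Mean-field Blume--Capel model. Let $\Lambda=\{1,0,-1\}$. For $n\in\mathbb N$, $K>0$ and $\omega=(\omega_1,\dots,\omega_n)\in\Lambda^n$ put $S_n(\omega)=\sum_{j=1}^n\omega_j$ and $H_{n,K}(\omega)=\sum_{j=1}^n\omega_j^2-\frac Kn\bigl(\sum_{j=1}^n\omega_j\bigr)^2$. For $\beta>0$, $P_{n,\beta,K}$ is the probability measure on $\Lambda^n$ giving $\omega$ probability proportional to $\exp[-\beta H_{n,K}(\omega)]$; $E_{n,\beta,K}$ denotes expectation with respect to $P_{n,\beta,K}$. Free-energy functional: $c_\beta(t)=\log\frac{1+e^{-\beta}(e^t+e^{-t})}{1+2e^{-\beta}}$ and $G_{\beta,K}(x)=\beta Kx^2-c_\beta(2\beta Kx)$ for $x\in\mathbb R$. $\mathcal M_{\beta,K}$ is the set of global minimum points of $G_{\beta,K}$. Let $\beta_c=\log4$ and $K(\beta)=(e^\beta+2)/(4\beta)$ for $\beta>0$. The points $(\beta,K(\beta))$ with $0<\beta<\beta_c$ are called second-order points and $(\beta_c,K(\beta_c))$ the tricritical point. The phase-coexistence region is the set of $(\beta,K)$, $\beta,K>0$, for which $\mathcal M_{\beta,K}$ has more than one element. It is known that for such $(\beta,K)$, $\mathcal M_{\beta,K}$ is $\{\pm m(\beta,K)\}$ or $\{0,\pm m(\beta,K)\}$ with $m(\beta,K)>0$; this unique positive global minimum point $m(\beta,K)$ is the thermodynamic magnetization. Notation: $a_n\sim b_n$ means $a_n/b_n\to1$ and $a_n\gg b_n$ means $a_n/b_n\to\infty$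 as $n\to\infty$. The quantity $m(\beta_n,K_n)$ is considered for $n$ large enough that $(\beta_n,K_n)$ lies in the phase-coexistence region. *)

theory Defs
  imports
    "HOL-Probability.Probability"
    "HOL-Computational_Algebra.Polynomial"
    "HOL-Library.Landau_Symbols"
begin

definition configs :: "nat \<Rightarrow> (nat \<Rightarrow> real) set" where
  "configs n = {1..n} \<rightarrow>\<^sub>E {1, 0, -1}"

definition total_spin :: "nat \<Rightarrow> (nat \<Rightarrow> real) \<Rightarrow> real" where
  "total_spin n \<omega> = (\<Sum>j=1..n. \<omega> j)"

definition hamiltonian :: "nat \<Rightarrow> real \<Rightarrow> (nat \<Rightarrow> real) \<Rightarrow> real" where
  "hamiltonian n K \<omega> = (\<Sum>j=1..n. (\<omega> j)\<^sup>2) - K / real n * (\<Sum>j=1..n. \<omega> j)\<^sup>2"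

definition partition_fn :: "nat \<Rightarrow> real \<Rightarrow> real \<Rightarrow> real" where
  "partition_fn n \<beta> K = (\<Sum>\<omega>\<in>configs n. exp (- \<beta> * hamiltonian n K \<omega>))"

definition blume_capel :: "nat \<Rightarrow> real \<Rightarrow> real \<Rightarrow> (nat \<Rightarrow> real) measure" where
  "blume_capel n \<beta> K =
     point_measure (configs n)
       (\<lambda>\<omega>. ennreal (exp (- \<beta> * hamiltonian n K \<omega>) / partition_fn n \<beta> K))"

lemma finite_configs: "finite (configs n)"
  unfolding configs_def by (intro finite_PiE) auto

lemma configs_nonempty: "configs n \<noteq> {}"
  unfolding configs_def by (simp add: PiE_eq_empty_iff)

lemma partition_fn_pos: "0 < partition_fn n \<beta> K"
  unfolding partition_fn_def
  by (intro sum_pos finite_configs configs_nonempty) simp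

lemma prob_space_blume_capel: "prob_space (blume_capel n \<beta> K)"
  unfolding blume_capel_def
proof (rule prob_space_point_measure)
  show "finite (configs n)" by (rule finite_configs)
  show "0 \<le> ennreal (exp (- \<beta> * hamiltonian n K \<omega>) / partition_fn n \<beta> K)" for \<omega>
    by simp
  have "(\<Sum>\<omega>\<in>configs n. exp (- \<beta> * hamiltonian n K \<omega>) / partition_fn n \<beta> K) = 1"
    using partition_fn_pos[of n \<beta> K]
    unfolding partition_fn_def sum_divide_distrib[symmetric] by simp
  then show "(\<Sum>\<omega>\<in>configs n. ennreal (exp (- \<beta> * hamiltonian n K \<omega>) / partition_fn n \<beta> K)) = 1"
    using partition_fn_pos[of n \<beta> K] by (subst sum_ennreal) (auto simp: less_imp_le)
qed

definition mean_abs_spin :: "nat \<Rightarrow> real \<Rightarrow> real \<Rightarrow> real" where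
  "mean_abs_spin n \<beta> K = (\<integral>\<omega>. \<bar>total_spin n \<omega> / real n\<bar> \<partial>blume_capel n \<beta> K)"

definition cumulant :: "real \<Rightarrow> real \<Rightarrow> real" where
  "cumulant \<beta> t = ln ((1 + exp (- \<beta>) * (exp t + exp (- t))) / (1 + 2 * exp (- \<beta>)))"

definition free_energy :: "real \<Rightarrow> real \<Rightarrow> real \<Rightarrow> real" where
  "free_energy \<beta> K x = \<beta> * K * x\<^sup>2 - cumulant \<beta> (2 * \<beta> * K * x)"

definition global_min_points :: "(real \<Rightarrow> real) \<Rightarrow> real set" where
  "global_min_points f = {x. \<forall>y. f x \<le> f y}"

abbreviation equil_macrostates :: "real \<Rightarrow> real \<Rightarrow> real set" where
  "equil_macrostates \<beta> K \<equiv> global_min_points (free_energy \<beta> K)"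

definition beta_crit :: real where
  "beta_crit = ln 4"

definition K_crit :: "real \<Rightarrow> real" where
  "K_crit \<beta> = (exp \<beta> + 2) / (4 * \<beta>)"

definition phase_coexistence :: "(real \<times> real) set" where
  "phase_coexistence =
     {(\<beta>, K). 0 < \<beta> \<and> 0 < K \<and>
        (\<exists>x\<in>equil_macrostates \<beta> K. \<exists>y\<in>equil_macrostates \<beta> K. x \<noteq> y)}"

text \<open>Meaningful only on the phase-coexistence region, where the positive global minimum
  point exists and is unique.\<close>

definition magnetization :: "real \<Rightarrow> real \<Rightarrow> real" where
  "magnetization \<beta> K = (THE x. 0 < x \<and> x \<in> equil_macrostates \<beta> K)"

definition even_coercive_4_6 :: "real poly \<Rightarrow> bool" where
  "even_coercive_4_6 p \<longleftrightarrow>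
     (\<forall>x. poly p (- x) = poly p x) \<and> degree p \<in> {4, 6} \<and>
     filterlim (poly p) at_top at_infinity"

definition gibbs_abs_moment :: "real poly \<Rightarrow> real" where
  "gibbs_abs_moment p =
     1 / (\<integral>x. exp (- poly p x) \<partial>lborel) * (\<integral>x. \<bar>x\<bar> * exp (- poly p x) \<partial>lborel)"

end

theory Submission
  imports Defs "HOL-Real_Asymp.Real_Asymp"
begin

text \<open>
  Write \<open>\<gamma> = \<theta> * \<alpha>\<^sub>0\<close>. Adding to \<open>S\<^sub>n / n\<close> an independent centred Gaussian of variance
  \<open>1 / (2 n \<beta> K)\<close> linearises the quadratic interaction and produces a real random variable with
  density proportional to \<open>exp (- n * G(x))\<close>, where \<open>G\<close> is the free-energy functional (the
  Hubbard--Stratonovich transformation). The Gaussian perturbs \<open>E |S\<^sub>n / n|\<close> by at most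
  \<open>1 / sqrt (pi n \<beta> K)\<close> (lemma \<open>mean_abs_spin_near_free_energy_moment\<close>), which is negligible
  against \<open>n powr (- \<gamma>)\<close> because \<open>\<gamma> < 1/2\<close>. After the substitution \<open>x = y / n powr \<gamma>\<close> the
  exponent is \<open>n * G(y / n powr \<gamma>)\<close>, which converges pointwise to the polynomial \<open>gt\<close>. The first
  claim is then dominated convergence, and the whole difficulty is to find a dominating function.

  The domination comes from the shape of \<open>G\<close> rather than from Taylor expansions at the critical
  point. Regard \<open>G\<close> as a function of \<open>s = x\<^sup>2\<close>. For all positive \<open>\<beta>\<close> and \<open>K\<close> this function is
  concave up to some point, possibly 0, and convex after it. The reason is that \<open>c\<^sub>\<beta>'(t) / t\<close> is first
  increasing and then decreasing, and its critical points solve \<open>N(t) = exp \<beta> / 2\<close> with \<open>N\<close>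
  strictly increasing (lemmas \<open>crossing_ratio_less\<close> and \<open>radial_slope_dichotomy\<close>). This shape
  survives every rescaling of argument and value. The limit \<open>gt\<close>, viewed as a function of \<open>s\<close>,
  is strictly convex and increasing far out. So for large \<open>n\<close> the
  rescaled \<open>G\<close> cannot still be concave there; it is convex from a fixed \<open>s\<close> on, and a chord
  that converges to a chord of positive slope bounds it below by \<open>c * y\<^sup>2\<close> uniformly in \<open>n\<close>
  (lemma \<open>eventually_quadratic_growth\<close>). On the remaining bounded range of \<open>y\<close>, hypothesis
  \<open>hyp_iv\<close> supplies a constant lower bound.

  The second claim uses the growth lemma a second time, on the scale \<open>n powr (\<theta> * \<alpha>)\<close>: there the
  rescaled \<open>G\<close> converges to \<open>g\<close>, hence is positive beyond a fixed \<open>Y\<close>, whereas at its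
  minimum point \<open>m\<close> it is at most \<open>G 0 = 0\<close>. So \<open>m \<le> Y / n powr (\<theta> * \<alpha>)\<close>,
  which is of smaller order than \<open>n powr (- \<gamma>)\<close>. That \<open>m\<close> is well defined in the coexistence
  region follows from the same one-crossing property.
\<close>

section \<open>A hyperbolic ratio with a single crossing\<close>

lemma pos_if_deriv_pos:
  fixes f f' :: "real \<Rightarrow> real"
  assumes "\<And>x. (f has_real_derivative f' x) (at x)" "f 0 = 0" "\<And>x. x > 0 \<Longrightarrow> f' x > 0" "t > 0"
  shows "f t > 0"
proof -
  have "f 0 < f t"
    by (rule DERIV_pos_imp_increasing_open[of 0 t f])
       (use assms in \<open>auto intro!: continuous_at_imp_continuous_on DERIV_isCont\<close>)
  then show ?thesis using assms(2) by simp
qed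

lemma sinh_less_mult_cosh: "sinh t < t * cosh t" if "t > 0" for t :: real
proof -
  have "t * cosh t - sinh t > 0"
    by (rule pos_if_deriv_pos[where f = "\<lambda>t. t * cosh t - sinh t" and f' = "\<lambda>t. t * sinh t"])
       (use that in \<open>auto intro!: derivative_eq_intros\<close>)
  then show ?thesis by simp
qed

text \<open>
  This inequality carries the one-crossing property. In terms of \<open>u = 2 * t\<close> it reads
  \<open>4 * cosh u < u * sinh u + u\<^sup>2 + 4\<close>, whose two sides agree to fourth order at 0; differentiating
  three times reduces it to \<open>sinh u < u * cosh u\<close>.
\<close>
lemma two_sinh_sq_less: "2 * (sinh t)\<^sup>2 < t * sinh t * cosh t + t\<^sup>2" if "t > 0" for t :: real
proof -
  have 1: "u * sinh u + 2 - 2 * cosh u > 0" if "u > 0" for u :: real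
    by (rule pos_if_deriv_pos[where f = "\<lambda>u. u * sinh u + 2 - 2 * cosh u" and f' = "\<lambda>u. u * cosh u - sinh u"])
       (use that sinh_less_mult_cosh in \<open>auto intro!: derivative_eq_intros\<close>)
  have 2: "u * cosh u + 2 * u - 3 * sinh u > 0" if "u > 0" for u :: real
    by (rule pos_if_deriv_pos[where f = "\<lambda>u. u * cosh u + 2 * u - 3 * sinh u"
            and f' = "\<lambda>u. u * sinh u + 2 - 2 * cosh u"])
       (use that 1 in \<open>auto intro!: derivative_eq_intros\<close>)
  have 3: "u * sinh u + u\<^sup>2 + 4 - 4 * cosh u > 0" if "u > 0" for u :: real
    by (rule pos_if_deriv_pos[where f = "\<lambda>u. u * sinh u + u\<^sup>2 + 4 - 4 * cosh u"
            and f' = "\<lambda>u. u * cosh u + 2 * u - 3 * sinh u"])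
       (use that 2 in \<open>auto intro!: derivative_eq_intros\<close>)
  \<comment> \<open>the case \<open>u = 2 * t\<close> of the last inequality\<close>
  have "sinh (2 * t) = 2 * sinh t * cosh t" "cosh (2 * t) = 1 + 2 * (sinh t)\<^sup>2"
    by (simp_all add: sinh_double cosh_double cosh_square_eq)
  then show ?thesis using 3[of "2 * t"] that by (simp add: power2_eq_square algebra_simps)
qed

text \<open>
  The numerator of the derivative factors as \<open>sinh t\<close> times the difference of the two sides in
  \<open>two_sinh_sq_less\<close>.
\<close>
lemma crossing_ratio_less:
  fixes s t :: real
  assumes "0 < s" "s < t"
  shows "(sinh s * cosh s - s) / (s * cosh s - sinh s) < (sinh t * cosh t - t) / (t * cosh t - sinh t)"
proof (rule DERIV_pos_imp_increasing[OF assms(2)])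
  fix x :: real assume x: "s \<le> x" "x \<le> t"
  let ?A = "sinh x * cosh x - x" and ?B = "x * cosh x - sinh x"
  have B: "?B > 0" using sinh_less_mult_cosh[of x] x assms by simp
  have D: "((\<lambda>x. (sinh x * cosh x - x) / (x * cosh x - sinh x)) has_real_derivative
         ((cosh x * cosh x + sinh x * sinh x - 1) * ?B - ?A * (x * sinh x)) / (?B * ?B)) (at x)"
    using B by (auto intro!: derivative_eq_intros)
  have "(cosh x * cosh x + sinh x * sinh x - 1) * ?B - ?A * (x * sinh x)
     = sinh x * (x * sinh x * cosh x + x\<^sup>2 - 2 * (sinh x)\<^sup>2)"
    using cosh_square_eq[of x] by (simp add: power2_eq_square algebra_simps)
  also have "\<dots> > 0" using two_sinh_sq_less[of x] x assms by simp
  finally have "((cosh x * cosh x + sinh x * sinh x - 1) * ?B - ?A * (x * sinh x)) / (?B * ?B) > 0"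
    using B by (intro divide_pos_pos) auto
  with D show "\<exists>y. ((\<lambda>x. (sinh x * cosh x - x) / (x * cosh x - sinh x)) has_real_derivative y) (at x) \<and> 0 < y"
    by blast
qed

text \<open>
  With \<open>q = exp \<beta> / 2\<close>, \<open>r t\<close> is \<open>c\<^sub>\<beta>'(t) / t\<close>, twice the derivative of the cumulant generating
  function with respect to \<open>t\<^sup>2\<close>. The sign of \<open>r'\<close> is that of \<open>q - N t\<close>, where \<open>N\<close> is the strictly
  increasing ratio of \<open>crossing_ratio_less\<close>, so \<open>r'\<close> changes sign at most once. Stating this as an
  alternative at an arbitrary point \<open>x\<close> avoids having to name the crossing point, which is 0
  for \<open>\<beta> \<le> log 4\<close>.
\<close>
lemma cumulant_slope_dichotomy:
  fixes q x :: real
  assumes q: "q > 0" and x: "x > 0"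
  defines "r \<equiv> \<lambda>t. sinh t / (t * (q + cosh t))"
  shows "(\<forall>s t. 0 < s \<longrightarrow> s < t \<longrightarrow> t \<le> x \<longrightarrow> r s < r t) \<or> (\<forall>s t. x \<le> s \<longrightarrow> s < t \<longrightarrow> r t < r s)"
proof -
  define N where "N \<equiv> \<lambda>t::real. (sinh t * cosh t - t) / (t * cosh t - sinh t)"
  have mono: "N s < N t" if "0 < s" "s < t" for s t
    using crossing_ratio_less[OF that] by (simp add: N_def)
  have D: "(r has_real_derivative (t * cosh t - sinh t) * (q - N t) / (t * (q + cosh t))\<^sup>2) (at t)"
    if "t > 0" for t
  proof -
    have nz: "q + cosh t \<noteq> 0" using add_pos_pos[OF q cosh_real_pos[of t]] by linarith
    have B: "t * cosh t - sinh t > 0" using sinh_less_mult_cosh[OF that] by simp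
    have "(r has_real_derivative
        (cosh t * (t * (q + cosh t)) - sinh t * (q + cosh t + t * sinh t)) / (t * (q + cosh t))\<^sup>2) (at t)"
      unfolding r_def using nz that
      by (auto intro!: derivative_eq_intros simp: power2_eq_square)
    moreover have "cosh t * (t * (q + cosh t)) - sinh t * (q + cosh t + t * sinh t)
       = (t * cosh t - sinh t) * (q - N t)"
    proof -
      have "(t * cosh t - sinh t) * N t = sinh t * cosh t - t" using B by (simp add: N_def)
      then show ?thesis using cosh_square_eq[of t] by (simp add: power2_eq_square algebra_simps)
    qed
    ultimately show ?thesis by simp
  qed
  have pos: "(t * cosh t - sinh t) / (t * (q + cosh t))\<^sup>2 > 0" if "t > 0" for t
  proof (intro divide_pos_pos zero_less_power mult_pos_pos)
    show "q + cosh t > 0" using q cosh_real_pos[of t] by linarith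
  qed (use that sinh_less_mult_cosh[OF that] in auto)
  have cont: "continuous_on S r" if "\<And>t. t \<in> S \<Longrightarrow> t > 0" for S
    using that D by (intro continuous_at_imp_continuous_on) (blast intro: DERIV_isCont)
  show ?thesis
  proof (cases "N x \<le> q")
    case True
    have "r s < r t" if st: "0 < s" "s < t" "t \<le> x" for s t
    proof (rule DERIV_pos_imp_increasing_open[OF st(2)])
      fix u assume u: "s < u" "u < t"
      have "N u < q" using mono[of u x] u st True by auto
      then have "(u * cosh u - sinh u) / (u * (q + cosh u))\<^sup>2 * (q - N u) > 0"
        using pos[of u] u st by (intro mult_pos_pos) auto
      then show "\<exists>y. (r has_real_derivative y) (at u) \<and> y > 0"
        using D[of u] u st by (intro exI[of _ "(u * cosh u - sinh u) * (q - N u) / (u * (q + cosh u))\<^sup>2"]) auto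
    qed (use st in \<open>auto intro!: cont\<close>)
    then show ?thesis by blast
  next
    case False
    have "r t < r s" if st: "x \<le> s" "s < t" for s t
    proof (rule DERIV_neg_imp_decreasing_open[OF st(2)])
      fix u assume u: "s < u" "u < t"
      have "N u > q" using mono[of x u] u st False x by auto
      then have "(u * cosh u - sinh u) / (u * (q + cosh u))\<^sup>2 * (q - N u) < 0"
        using pos[of u] u st x by (intro mult_pos_neg) auto
      then show "\<exists>y. (r has_real_derivative y) (at u) \<and> y < 0"
        using D[of u] u st x by (intro exI[of _ "(u * cosh u - sinh u) * (q - N u) / (u * (q + cosh u))\<^sup>2"]) auto
    qed (use st x in \<open>auto intro!: cont\<close>)
    then show ?thesis by blast
  qed
qed

section \<open>The free energy as a function of the squared argument\<close>

text \<open>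
  Closed form of \<open>G'(x) / x\<close>, twice the derivative of \<open>G\<close> with respect to \<open>x\<^sup>2\<close>.
\<close>
definition radial_slope :: "real \<Rightarrow> real \<Rightarrow> real \<Rightarrow> real" where
  "radial_slope \<beta> K x = 2 * (\<beta> * K) -
     2 * (\<beta> * K) * (sinh (2 * \<beta> * K * x) / (x * (exp \<beta> / 2 + cosh (2 * \<beta> * K * x))))"

lemma cumulant_deriv:
  "(cumulant \<beta> has_real_derivative sinh t / (exp \<beta> / 2 + cosh t)) (at t)"
proof -
  have pos: "1 + exp (- \<beta>) * (exp t + exp (- t)) > 0" "1 + 2 * exp (- \<beta>) > 0"
    by (simp_all add: add_pos_pos)
  have "(cumulant \<beta> has_real_derivative
      (exp (- \<beta>) * (exp t - exp (- t))) / (1 + exp (- \<beta>) * (exp t + exp (- t)))) (at t)"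
  proof -
    have "((\<lambda>t. ln (1 + exp (- \<beta>) * (exp t + exp (- t))) - ln (1 + 2 * exp (- \<beta>))) has_real_derivative
      (exp (- \<beta>) * (exp t - exp (- t))) / (1 + exp (- \<beta>) * (exp t + exp (- t)))) (at t)"
      using pos by (auto intro!: derivative_eq_intros)
    moreover have "cumulant \<beta> = (\<lambda>t. ln (1 + exp (- \<beta>) * (exp t + exp (- t))) - ln (1 + 2 * exp (- \<beta>)))"
      unfolding cumulant_def[abs_def] using pos
      by (intro ext ln_divide_pos) (simp_all add: add_pos_pos)
    ultimately show ?thesis by simp
  qed
  moreover have "(exp (- \<beta>) * (exp t - exp (- t))) / (1 + exp (- \<beta>) * (exp t + exp (- t)))
      = sinh t / (exp \<beta> / 2 + cosh t)"
  proof -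
    have halve: "a / b = (a / 2) / (b / 2)" for a b :: real by simp
    have "(exp (- \<beta>) * (exp t - exp (- t))) / (1 + exp (- \<beta>) * (exp t + exp (- t)))
       = (exp \<beta> * (exp (- \<beta>) * (exp t - exp (- t)))) / (exp \<beta> * (1 + exp (- \<beta>) * (exp t + exp (- t))))"
      by simp
    also have "\<dots> = (exp t - exp (- t)) / (exp \<beta> + (exp t + exp (- t)))"
      by (simp add: distrib_left mult.assoc[symmetric] flip: exp_add)
    also have "\<dots> = ((exp t - exp (- t)) / 2) / ((exp \<beta> + (exp t + exp (- t))) / 2)"
      by (rule halve)
    also have "\<dots> = sinh t / (exp \<beta> / 2 + cosh t)"
      by (simp add: sinh_field_def cosh_field_def add_divide_distrib)
    finally show ?thesis .
  qed
  ultimately show ?thesis by simp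
qed

lemma free_energy_deriv:
  assumes "x \<noteq> 0"
  shows "(free_energy \<beta> K has_real_derivative x * radial_slope \<beta> K x) (at x)"
proof -
  have "(free_energy \<beta> K has_real_derivative \<beta> * K * (2 * x) -
      sinh (2 * \<beta> * K * x) / (exp \<beta> / 2 + cosh (2 * \<beta> * K * x)) * (2 * \<beta> * K)) (at x)"
    unfolding free_energy_def[abs_def]
    by (auto intro!: derivative_eq_intros DERIV_chain2[OF cumulant_deriv])
  moreover have "x * radial_slope \<beta> K x = 2 * (\<beta> * K) * x - 2 * (\<beta> * K) *
      (x * sinh (2 * \<beta> * K * x) / (x * (exp \<beta> / 2 + cosh (2 * \<beta> * K * x))))"
    unfolding radial_slope_def by (simp add: algebra_simps)
  then have "x * radial_slope \<beta> K x = \<beta> * K * (2 * x) -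
      sinh (2 * \<beta> * K * x) / (exp \<beta> / 2 + cosh (2 * \<beta> * K * x)) * (2 * \<beta> * K)"
    using assms by (simp add: mult_ac)
  ultimately show ?thesis by simp
qed

lemma free_energy_zero [simp]: "free_energy \<beta> K 0 = 0"
proof -
  have "1 + 2 * exp (- \<beta>) \<noteq> 0" by (smt (verit) exp_gt_zero)
  then show ?thesis by (simp add: free_energy_def cumulant_def mult.commute)
qed

lemma free_energy_minus [simp]: "free_energy \<beta> K (- x) = free_energy \<beta> K x"
  by (simp add: free_energy_def cumulant_def add.commute)

lemma free_energy_abs [simp]: "free_energy \<beta> K \<bar>x\<bar> = free_energy \<beta> K x"
  by (simp add: abs_if)

lemma radial_slope_dichotomy:
  assumes "\<beta> > 0" "K > 0" "x > 0"
  shows "(\<forall>s t. 0 < s \<longrightarrow> s < t \<longrightarrow> t \<le> x \<longrightarrow> radial_slope \<beta> K t < radial_slope \<beta> K s) \<or>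
         (\<forall>s t. x \<le> s \<longrightarrow> s < t \<longrightarrow> radial_slope \<beta> K s < radial_slope \<beta> K t)"
proof -
  define r where "r \<equiv> \<lambda>t. sinh t / (t * (exp \<beta> / 2 + cosh t))"
  define k where "k = 2 * \<beta> * K"
  have k: "k > 0" using assms by (simp add: k_def)
  have eq: "radial_slope \<beta> K y = k - k\<^sup>2 * r (k * y)" for y
  proof -
    have "radial_slope \<beta> K y = k - k * (sinh (k * y) / (y * (exp \<beta> / 2 + cosh (k * y))))"
      by (simp add: radial_slope_def k_def mult_ac)
    also have "sinh (k * y) / (y * (exp \<beta> / 2 + cosh (k * y))) = k * r (k * y)"
      using k by (simp add: r_def)
    finally show ?thesis by (simp add: power2_eq_square)
  qed
  have "(\<forall>s t. 0 < s \<longrightarrow> s < t \<longrightarrow> t \<le> k * x \<longrightarrow> r s < r t) \<or> (\<forall>s t. k * x \<le> s \<longrightarrow> s < t \<longrightarrow> r t < r s)"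
    unfolding r_def by (rule cumulant_slope_dichotomy) (use k assms in auto)
  then show ?thesis
    unfolding eq using k by (auto simp: mult_left_mono)
qed

section \<open>Quadratic growth uniform along a sequence\<close>

text \<open>
  In the variable \<open>u = x\<^sup>2\<close> the derivative is a positive multiple of \<open>radial_slope\<close>, so its
  monotonicity alternative becomes one between concavity and convexity. The square root is
  not differentiable at 0, which is why the concave side stops at a positive \<open>r\<close>.
\<close>
lemma rescaled_free_energy_dichotomy:
  fixes \<beta> K a b s :: real
  assumes pos: "\<beta> > 0" "K > 0" "a > 0" "b > 0" "s > 0"
  defines "h \<equiv> \<lambda>u. a * free_energy \<beta> K (sqrt u / b)"
  shows "(\<forall>r>0. concave_on {r..s} h) \<or> convex_on {s..} h"
proof -
  define h' where "h' \<equiv> \<lambda>u. a / (2 * b\<^sup>2) * radial_slope \<beta> K (sqrt u / b)"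
  have D: "(h has_real_derivative h' u) (at u)" if "u > 0" for u
  proof -
    have "(h has_real_derivative a * ((sqrt u / b * radial_slope \<beta> K (sqrt u / b)) * ((inverse (sqrt u) / 2) / b))) (at u)"
      unfolding h_def using that pos
      by (intro DERIV_cmult DERIV_chain2[OF free_energy_deriv] DERIV_cdivide DERIV_real_sqrt) auto
    moreover have "a * ((sqrt u / b * radial_slope \<beta> K (sqrt u / b)) * ((inverse (sqrt u) / 2) / b)) = h' u"
      using that pos by (simp add: h'_def power2_eq_square field_simps)
    ultimately show ?thesis by simp
  qed
  consider (dec) "\<forall>x y. 0 < x \<longrightarrow> x < y \<longrightarrow> y \<le> sqrt s / b \<longrightarrow> radial_slope \<beta> K y < radial_slope \<beta> K x"
    | (inc) "\<forall>x y. sqrt s / b \<le> x \<longrightarrow> x < y \<longrightarrow> radial_slope \<beta> K x < radial_slope \<beta> K y"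
    using radial_slope_dichotomy[OF pos(1,2), of "sqrt s / b"] pos by auto
  then show ?thesis
  proof cases
    case dec
    have "concave_on {r..s} h" if "r > 0" for r
      unfolding concave_on_def
    proof (rule convex_on_realI)
      fix x assume "x \<in> {r..s}"
      then show "((\<lambda>x. - h x) has_real_derivative - h' x) (at x)"
        using D[of x] that by (auto intro!: derivative_eq_intros)
    next
      fix x y assume xy: "x \<in> {r..s}" "y \<in> {r..s}" "x \<le> y"
      have "radial_slope \<beta> K (sqrt y / b) \<le> radial_slope \<beta> K (sqrt x / b)"
      proof (cases "x = y")
        case False
        have "radial_slope \<beta> K (sqrt y / b) < radial_slope \<beta> K (sqrt x / b)"
          using False xy that pos by (intro dec[rule_format]) (auto simp: divide_simps)
        then show ?thesis by simp
      qed simp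
      then show "- h' x \<le> - h' y"
        unfolding h'_def neg_le_iff_le using pos by (intro mult_left_mono) auto
    qed auto
    then show ?thesis by blast
  next
    case inc
    have "convex_on {s..} h"
    proof (rule convex_on_realI)
      fix x assume "x \<in> {s..}"
      then show "(h has_real_derivative h' x) (at x)" using D[of x] pos by auto
    next
      fix x y assume xy: "x \<in> {s..}" "y \<in> {s..}" "x \<le> y"
      have "radial_slope \<beta> K (sqrt x / b) \<le> radial_slope \<beta> K (sqrt y / b)"
      proof (cases "x = y")
        case False
        have "radial_slope \<beta> K (sqrt x / b) < radial_slope \<beta> K (sqrt y / b)"
          using False xy pos by (intro inc[rule_format]) (auto simp: divide_simps)
        then show ?thesis by simp
      qed simp
      then show "h' x \<le> h' y"
        unfolding h'_def using pos by (intro mult_left_mono) auto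
    qed auto
    then show ?thesis by blast
  qed
qed

lemma even_coercive_4_6_form:
  assumes "even_coercive_4_6 p"
  obtains c0 c2 c4 c6 where "\<And>y. poly p y = c0 + c2 * y^2 + c4 * y^4 + c6 * y^6"
    "c6 > 0 \<or> (c6 = 0 \<and> c4 > 0)"
proof
  have deg: "degree p = 4 \<or> degree p = 6" and sym: "\<And>x. poly p (- x) = poly p x"
    and lim: "filterlim (poly p) at_top at_top"
    using assms filterlim_mono[OF _ order_refl at_top_le_at_infinity]
    by (auto simp: even_coercive_4_6_def)
  have sum: "poly p y = (\<Sum>i\<le>6. coeff p i * y ^ i)" for y
    unfolding poly_altdef by (rule sum.mono_neutral_left) (use deg in \<open>auto simp: coeff_eq_0\<close>)
  show form: "poly p y = coeff p 0 + coeff p 2 * y^2 + coeff p 4 * y^4 + coeff p 6 * y^6" for y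
  proof -
    \<comment> \<open>averaging over \<open>y\<close> and \<open>- y\<close> removes the odd powers\<close>
    have "2 * poly p y = poly p y + poly p (- y)" by (simp add: sym)
    also have "\<dots> = 2 * (coeff p 0 + coeff p 2 * y^2 + coeff p 4 * y^4 + coeff p 6 * y^6)"
      unfolding sum by (simp add: eval_nat_numeral algebra_simps)
    finally show ?thesis by simp
  qed
  have not_bot: "\<not> filterlim (poly p) at_bot at_top"
  proof
    assume "filterlim (poly p) at_bot at_top"
    then have "eventually (\<lambda>y. poly p y < 0) at_top" by (simp add: filterlim_at_bot_dense)
    moreover have "eventually (\<lambda>y. poly p y > 0) at_top" using lim by (simp add: filterlim_at_top_dense)
    ultimately have "eventually (\<lambda>y::real. False) at_top" by eventually_elim simp
    then show False by simp
  qed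
  have eq: "poly p = (\<lambda>y. coeff p 0 + coeff p 2 * y^2 + coeff p 4 * y^4 + coeff p 6 * y^6)"
    using form by auto
  show "coeff p 6 > 0 \<or> (coeff p 6 = 0 \<and> coeff p 4 > 0)"
  proof (cases "degree p = 6")
    case True
    then have nz: "coeff p 6 \<noteq> 0" using leading_coeff_0_iff[of p] by auto
    have "\<not> coeff p 6 < 0"
    proof
      assume "coeff p 6 < 0"
      then have "filterlim (poly p) at_bot at_top" unfolding eq by real_asymp
      with not_bot show False ..
    qed
    with nz show ?thesis by simp
  next
    case False
    then have "degree p = 4" using deg by simp
    then have nz: "coeff p 4 \<noteq> 0" "coeff p 6 = 0"
      using leading_coeff_0_iff[of p] by (auto simp: coeff_eq_0)
    have "\<not> coeff p 4 < 0"
    proof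
      assume "coeff p 4 < 0"
      then have "filterlim (poly p) at_bot at_top" unfolding eq nz(2) mult_zero_left add_0_right by real_asymp
      with not_bot show False ..
    qed
    with nz show ?thesis by simp
  qed
qed

text \<open>
  Four equally spaced nodes witness that the polynomial, in the variable \<open>s = y\<^sup>2\<close>, is convex and
  increasing far out. These are strict inequalities between finitely many values, so they pass to
  any sequence of functions that converges pointwise.
\<close>
lemma even_coercive_4_6_nodes:
  assumes "even_coercive_4_6 p"
  defines "P \<equiv> \<lambda>s. poly p (sqrt s)"
  obtains \<sigma> where "\<sigma> > 0" "2 * P (2 * \<sigma>) < P \<sigma> + P (3 * \<sigma>)" "P (3 * \<sigma>) < P (4 * \<sigma>)" "1 < P (4 * \<sigma>)"
proof -
  obtain c0 c2 c4 c6 where form: "\<And>y. poly p y = c0 + c2 * y^2 + c4 * y^4 + c6 * y^6"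
    and sgn: "c6 > 0 \<or> (c6 = 0 \<and> c4 > 0)"
    using even_coercive_4_6_form[OF assms(1)] by blast
  have P: "P s = c0 + c2 * s + c4 * s^2 + c6 * s^3" if "s \<ge> 0" for s
  proof -
    have "sqrt s ^ 4 = (sqrt s ^ 2) ^ 2" "sqrt s ^ 6 = (sqrt s ^ 2) ^ 3"
      by (simp_all flip: power_mult)
    then show ?thesis using that by (simp add: P_def form)
  qed
  \<comment> \<open>\<open>P s + P (3 * s) - 2 * P (2 * s)\<close> in terms of the coefficients, then
      \<open>P (4 * s) - P (3 * s)\<close> and \<open>P (4 * s)\<close>\<close>
  have "eventually (\<lambda>s. 2 * c4 * s^2 + 12 * c6 * s^3 > 0) at_top"
    using sgn
  proof (elim disjE conjE)
    assume "c6 > 0" then show ?thesis by real_asymp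
  next
    assume "c6 = 0" "c4 > 0" then show ?thesis unfolding \<open>c6 = 0\<close> mult_zero_right mult_zero_left add_0_right by real_asymp
  qed
  moreover have "eventually (\<lambda>s. c2 * s + 7 * c4 * s^2 + 37 * c6 * s^3 > 0) at_top"
    using sgn
  proof (elim disjE conjE)
    assume "c6 > 0" then show ?thesis by real_asymp
  next
    assume "c6 = 0" "c4 > 0" then show ?thesis unfolding \<open>c6 = 0\<close> mult_zero_right mult_zero_left add_0_right by real_asymp
  qed
  moreover have "eventually (\<lambda>s. c0 + 4 * c2 * s + 16 * c4 * s^2 + 64 * c6 * s^3 > 1) at_top"
    using sgn
  proof (elim disjE conjE)
    assume "c6 > 0" then show ?thesis by real_asymp
  next
    assume "c6 = 0" "c4 > 0" then show ?thesis unfolding \<open>c6 = 0\<close> mult_zero_right mult_zero_left add_0_right by real_asymp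
  qed
  ultimately have "eventually (\<lambda>s. s > 0 \<and> 2 * P (2 * s) < P s + P (3 * s) \<and> P (3 * s) < P (4 * s) \<and> 1 < P (4 * s)) at_top"
    using eventually_gt_at_top[of 0]
    by eventually_elim (simp add: P algebra_simps power_mult_distrib)
  then obtain \<sigma> where "\<sigma> > 0 \<and> 2 * P (2 * \<sigma>) < P \<sigma> + P (3 * \<sigma>) \<and> P (3 * \<sigma>) < P (4 * \<sigma>) \<and> 1 < P (4 * \<sigma>)"
    using eventually_happens'[OF trivial_limit_at_top_linorder] by blast
  then show ?thesis using that by blast
qed

text \<open>
  Pointwise convergence improves to a lower bound uniform in \<open>n\<close> and in all large \<open>y\<close>. The second
  difference at \<open>\<sigma>\<close>, \<open>2\<sigma>\<close>, \<open>3\<sigma>\<close> excludes the concave alternative, so the rescaled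
  free energy is convex in \<open>s = y\<^sup>2\<close> beyond \<open>3\<sigma>\<close> and stays above the line through its values at
  \<open>3\<sigma>\<close> and \<open>4\<sigma>\<close>. No relation between the scales \<open>a\<close> and \<open>b\<close> enters, so the lemma serves
  both scalings of the theorem.
\<close>
lemma eventually_quadratic_growth:
  fixes \<beta> K a b :: "nat \<Rightarrow> real"
  assumes p: "even_coercive_4_6 p"
    and lim: "\<And>y. (\<lambda>n. a n * free_energy (\<beta> n) (K n) (y / b n)) \<longlonglongrightarrow> poly p y"
    and pos: "\<forall>\<^sub>F n in sequentially. \<beta> n > 0 \<and> K n > 0 \<and> a n > 0 \<and> b n > 0"
  obtains c Y where "c > 0" "Y > 0"
    "\<forall>\<^sub>F n in sequentially. \<forall>y. Y \<le> \<bar>y\<bar> \<longrightarrow> c * y\<^sup>2 \<le> a n * free_energy (\<beta> n) (K n) (y / b n)"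
proof -
  define P where "P \<equiv> \<lambda>s. poly p (sqrt s)"
  define h where "h \<equiv> \<lambda>n s. a n * free_energy (\<beta> n) (K n) (sqrt s / b n)"
  obtain \<sigma> where \<sigma>: "\<sigma> > 0" "2 * P (2 * \<sigma>) < P \<sigma> + P (3 * \<sigma>)" "P (3 * \<sigma>) < P (4 * \<sigma>)" "1 < P (4 * \<sigma>)"
    using even_coercive_4_6_nodes[OF p] unfolding P_def by blast
  have hlim: "(\<lambda>n. h n s) \<longlonglongrightarrow> P s" for s
    unfolding h_def P_def by (rule lim)
  \<comment> \<open>half the slope of the limiting chord: the slope of the chord for \<open>n\<close> is eventually larger\<close>
  define \<kappa> where "\<kappa> = (P (4 * \<sigma>) - P (3 * \<sigma>)) / (2 * \<sigma>)"
  have \<kappa>: "\<kappa> > 0" using \<sigma> by (simp add: \<kappa>_def)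
  have ev1: "\<forall>\<^sub>F n in sequentially. 2 * h n (2 * \<sigma>) < h n \<sigma> + h n (3 * \<sigma>)"
  proof -
    have "(\<lambda>n. h n \<sigma> + h n (3 * \<sigma>) - 2 * h n (2 * \<sigma>)) \<longlonglongrightarrow> P \<sigma> + P (3 * \<sigma>) - 2 * P (2 * \<sigma>)"
      by (intro tendsto_intros hlim)
    from order_tendstoD(1)[OF this, of 0] \<sigma> show ?thesis by simp
  qed
  have ev2: "\<forall>\<^sub>F n in sequentially. h n (4 * \<sigma>) - h n (3 * \<sigma>) > \<kappa> * \<sigma>"
  proof (rule order_tendstoD(1))
    show "(\<lambda>n. h n (4 * \<sigma>) - h n (3 * \<sigma>)) \<longlonglongrightarrow> P (4 * \<sigma>) - P (3 * \<sigma>)"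
      by (intro tendsto_intros hlim)
    show "\<kappa> * \<sigma> < P (4 * \<sigma>) - P (3 * \<sigma>)" using \<sigma> by (simp add: \<kappa>_def)
  qed
  have ev3: "\<forall>\<^sub>F n in sequentially. h n (4 * \<sigma>) > 1"
    using order_tendstoD(1)[OF hlim \<sigma>(4)] .
  \<comment> \<open>chosen so that \<open>c * s\<close> lies below the line of slope \<open>\<kappa>\<close> with value 1 at \<open>4\<sigma>\<close>,
      for \<open>s \<ge> 4\<sigma>\<close>\<close>
  define c where "c = min \<kappa> (1 / (4 * \<sigma>))"
  have c: "c > 0" "c \<le> \<kappa>" "c * (4 * \<sigma>) \<le> 1"
    using \<kappa> \<sigma>(1) by (auto simp: c_def min_def field_simps)
  have "\<forall>\<^sub>F n in sequentially. \<forall>y. sqrt (4 * \<sigma>) \<le> \<bar>y\<bar> \<longrightarrow> c * y\<^sup>2 \<le> a n * free_energy (\<beta> n) (K n) (y / b n)"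
    using pos ev1 ev2 ev3
  proof eventually_elim
    case (elim n)
    have "\<not> concave_on {\<sigma>..3 * \<sigma>} (h n)"
    proof
      assume "concave_on {\<sigma>..3 * \<sigma>} (h n)"
      from concave_onD[OF this, of "1/2" \<sigma> "3 * \<sigma>"] \<sigma>(1) elim show False by (simp add: field_simps)
    qed
    then have conv: "convex_on {3 * \<sigma>..} (h n)"
      using rescaled_free_energy_dichotomy[of "\<beta> n" "K n" "a n" "b n" "3 * \<sigma>"] elim \<sigma>(1)
      unfolding h_def by auto
    have grow: "c * s \<le> h n s" if s: "s \<ge> 4 * \<sigma>" for s
    proof -
      \<comment> \<open>the weight that makes \<open>4\<sigma>\<close> a convex combination of \<open>3\<sigma>\<close> and \<open>s\<close>\<close>
      define t where "t = \<sigma> / (s - 3 * \<sigma>)"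
      have t: "0 < t" "t \<le> 1" using s \<sigma>(1) by (auto simp: t_def)
      have "h n ((1 - t) *\<^sub>R (3 * \<sigma>) + t *\<^sub>R s) \<le> (1 - t) * h n (3 * \<sigma>) + t * h n s"
        using t s \<sigma>(1) by (intro convex_onD[OF conv]) auto
      moreover have "(1 - t) *\<^sub>R (3 * \<sigma>) + t *\<^sub>R s = 4 * \<sigma>"
      proof -
        have "t * (s - 3 * \<sigma>) = \<sigma>" using s \<sigma>(1) by (simp add: t_def)
        then show ?thesis by (simp add: algebra_simps)
      qed
      ultimately have "h n (4 * \<sigma>) \<le> h n (3 * \<sigma>) + t * (h n s - h n (3 * \<sigma>))"
        by (simp add: algebra_simps)
      then have le: "h n (4 * \<sigma>) - h n (3 * \<sigma>) \<le> t * (h n s - h n (3 * \<sigma>))" by simp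
      then have "\<kappa> * \<sigma> \<le> t * (h n s - h n (3 * \<sigma>))" using elim by linarith
      then have "\<sigma> * (\<kappa> * (s - 3 * \<sigma>)) \<le> \<sigma> * (h n s - h n (3 * \<sigma>))"
        using s \<sigma>(1) by (simp add: t_def field_simps)
      then have "\<kappa> * (s - 3 * \<sigma>) \<le> h n s - h n (3 * \<sigma>)"
        using \<sigma>(1) by (simp only: mult_le_cancel_left_pos)
      moreover have "h n s - h n (3 * \<sigma>) - (h n (4 * \<sigma>) - h n (3 * \<sigma>)) \<ge> \<kappa> * (s - 4 * \<sigma>)"
      proof -
        have "(1 - t) * (h n s - h n (3 * \<sigma>)) \<ge> (1 - t) * (\<kappa> * (s - 3 * \<sigma>))"
          using calculation t by (intro mult_left_mono) auto
        moreover have "(1 - t) * (s - 3 * \<sigma>) = s - 4 * \<sigma>"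
          using s \<sigma>(1) by (simp add: t_def field_simps)
        then have "(1 - t) * (\<kappa> * (s - 3 * \<sigma>)) = \<kappa> * (s - 4 * \<sigma>)" by (simp add: mult.left_commute)
        moreover have "(1 - t) * (h n s - h n (3 * \<sigma>)) = (h n s - h n (3 * \<sigma>)) - t * (h n s - h n (3 * \<sigma>))"
          by (simp add: left_diff_distrib)
        ultimately show ?thesis using le by linarith
      qed
      moreover have "c * (s - 4 * \<sigma>) \<le> \<kappa> * (s - 4 * \<sigma>)"
        using c s by (intro mult_right_mono) auto
      ultimately show ?thesis using elim c(3) by (simp add: algebra_simps)
    qed
    show ?case
    proof (intro allI impI)
      fix y assume y: "sqrt (4 * \<sigma>) \<le> \<bar>y\<bar>"
      have "y\<^sup>2 \<ge> 4 * \<sigma>" using y by (metis real_sqrt_abs real_sqrt_le_iff)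
      from grow[OF this] have "c * y\<^sup>2 \<le> a n * free_energy (\<beta> n) (K n) (\<bar>y\<bar> / b n)"
        by (simp add: h_def)
      also have "\<bar>y\<bar> / b n = \<bar>y / b n\<bar>" using elim by simp
      finally show "c * y\<^sup>2 \<le> a n * free_energy (\<beta> n) (K n) (y / b n)" by (simp only: free_energy_abs)
    qed
  qed
  then show ?thesis using that[of c "sqrt (4 * \<sigma>)"] c \<sigma>(1) by simp
qed

section \<open>The Hubbard--Stratonovich transformation\<close>

lemma sum_configs_prod:
  fixes f :: "real \<Rightarrow> real"
  shows "(\<Sum>\<omega>\<in>configs n. \<Prod>j=1..n. f (\<omega> j)) = (f 1 + f 0 + f (-1)) ^ n"
proof -
  have "(\<Sum>\<omega>\<in>configs n. \<Prod>j=1..n. f (\<omega> j)) = (\<Prod>j=1..n. \<Sum>v\<in>{1,0,-1::real}. f v)"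
    unfolding configs_def by (rule prod_sum_PiE[symmetric]) auto
  then show ?thesis by (simp add: add.assoc)
qed

text \<open>
  Completing the square turns \<open>exp (\<beta> K S\<^sup>2 / n)\<close> times a Gaussian centred at \<open>S / n\<close> into
  \<open>exp (2 \<beta> K x S)\<close> times a Gaussian centred at 0. The exponent is then linear in \<open>S\<close>, so the sum
  over configurations factors over the sites.
\<close>
lemma hubbard_stratonovich:
  assumes "n \<ge> 1"
  shows "(1 + 2 * exp (- \<beta>)) ^ n * exp (- real n * free_energy \<beta> K x) =
    (\<Sum>\<omega>\<in>configs n. exp (- \<beta> * hamiltonian n K \<omega>) *
        exp (- real n * (\<beta> * K) * (x - total_spin n \<omega> / real n)\<^sup>2))"
proof -
  define t where "t = 2 * \<beta> * K * x"
  have summand: "exp (- \<beta> * hamiltonian n K \<omega>) * exp (- real n * (\<beta> * K) * (x - total_spin n \<omega> / real n)\<^sup>2)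
     = exp (- real n * (\<beta> * K) * x\<^sup>2) * (\<Prod>j=1..n. exp (- \<beta> * (\<omega> j)\<^sup>2 + t * \<omega> j))" for \<omega>
  proof -
    define S where "S = total_spin n \<omega>"
    define Q where "Q = (\<Sum>j=1..n. (\<omega> j)\<^sup>2)"
    have "(\<Prod>j=1..n. exp (- \<beta> * (\<omega> j)\<^sup>2 + t * \<omega> j)) = exp (- \<beta> * Q + t * S)"
      unfolding exp_sum[OF finite_atLeastAtMost, symmetric] S_def Q_def total_spin_def
      by (simp only: sum.distrib sum_distrib_left)
    moreover have "hamiltonian n K \<omega> = Q - K / real n * S\<^sup>2"
      by (simp add: hamiltonian_def Q_def S_def total_spin_def)
    moreover have "- \<beta> * (Q - K / real n * S\<^sup>2) + - real n * (\<beta> * K) * (x - S / real n)\<^sup>2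
       = - real n * (\<beta> * K) * x\<^sup>2 + (- \<beta> * Q + t * S)"
      using assms by (simp add: t_def power2_eq_square field_simps)
    ultimately show ?thesis unfolding S_def[symmetric] by (simp only: exp_add[symmetric])
  qed
  have pos: "1 + exp (- \<beta>) * (exp t + exp (- t)) > 0" "1 + 2 * exp (- \<beta>) > 0"
    by (simp_all add: add_pos_pos)
  have "(\<Sum>\<omega>\<in>configs n. exp (- \<beta> * hamiltonian n K \<omega>) *
        exp (- real n * (\<beta> * K) * (x - total_spin n \<omega> / real n)\<^sup>2))
     = exp (- real n * (\<beta> * K) * x\<^sup>2) * (\<Sum>\<omega>\<in>configs n. \<Prod>j=1..n. exp (- \<beta> * (\<omega> j)\<^sup>2 + t * \<omega> j))"
    unfolding summand sum_distrib_left ..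
  also have "(\<Sum>\<omega>\<in>configs n. \<Prod>j=1..n. exp (- \<beta> * (\<omega> j)\<^sup>2 + t * \<omega> j))
     = (1 + exp (- \<beta>) * (exp t + exp (- t))) ^ n"
    unfolding sum_configs_prod[where f = "\<lambda>v. exp (- \<beta> * v\<^sup>2 + t * v)"]
    by (simp add: exp_add exp_diff exp_minus field_simps)
  also have "\<dots> = (1 + 2 * exp (- \<beta>)) ^ n * exp (cumulant \<beta> t) ^ n"
    using pos by (simp add: cumulant_def power_divide)
  also have "exp (- real n * (\<beta> * K) * x\<^sup>2) * ((1 + 2 * exp (- \<beta>)) ^ n * exp (cumulant \<beta> t) ^ n)
     = (1 + 2 * exp (- \<beta>)) ^ n * exp (- real n * free_energy \<beta> K x)"
    by (simp add: free_energy_def t_def algebra_simps flip: exp_of_nat_mult exp_add)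
  finally show ?thesis by simp
qed

lemma normal_abs_moment_near_abs_mean:
  assumes "\<sigma> > 0"
  shows "integrable lborel (\<lambda>x. normal_density \<mu> \<sigma> x * \<bar>x\<bar>)"
    "\<bar>(\<integral>x. normal_density \<mu> \<sigma> x * \<bar>x\<bar> \<partial>lborel) - \<bar>\<mu>\<bar>\<bar> \<le> \<sigma> * sqrt (2 / pi)"
proof -
  have i0: "integrable lborel (normal_density \<mu> \<sigma>)" using assms by (rule integrable_normal_density)
  have i1: "integrable lborel (\<lambda>x. normal_density \<mu> \<sigma> x * \<bar>x - \<mu>\<bar>)"
    using integrable_normal_moment_abs[OF assms, of \<mu> 1] by simp
  have dev: "(\<integral>x. normal_density \<mu> \<sigma> x * \<bar>x - \<mu>\<bar> \<partial>lborel) = \<sigma> * sqrt (2 / pi)"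
    using integral_normal_moment_abs_odd[OF assms, of \<mu> 0] by simp
  show i2: "integrable lborel (\<lambda>x. normal_density \<mu> \<sigma> x * \<bar>x\<bar>)"
    using integrable_abs[OF integrable_normal_moment_nz_1[OF assms, of \<mu>]]
    by (simp add: abs_mult)
  have "(\<integral>x. normal_density \<mu> \<sigma> x * \<bar>x\<bar> \<partial>lborel) - \<bar>\<mu>\<bar>
      = (\<integral>x. normal_density \<mu> \<sigma> x * \<bar>x\<bar> - normal_density \<mu> \<sigma> x * \<bar>\<mu>\<bar> \<partial>lborel)"
    using i0 i2 assms by (subst Bochner_Integration.integral_diff) auto
  also have "\<bar>\<dots>\<bar> \<le> (\<integral>x. \<bar>normal_density \<mu> \<sigma> x * \<bar>x\<bar> - normal_density \<mu> \<sigma> x * \<bar>\<mu>\<bar>\<bar> \<partial>lborel)"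
    by (rule integral_abs_bound)
  also have "\<dots> \<le> (\<integral>x. normal_density \<mu> \<sigma> x * \<bar>x - \<mu>\<bar> \<partial>lborel)"
  proof (rule integral_mono)
    fix x
    have "\<bar>normal_density \<mu> \<sigma> x * (\<bar>x\<bar> - \<bar>\<mu>\<bar>)\<bar> \<le> normal_density \<mu> \<sigma> x * \<bar>x - \<mu>\<bar>"
      unfolding abs_mult by (intro mult_mono) auto
    then show "\<bar>normal_density \<mu> \<sigma> x * \<bar>x\<bar> - normal_density \<mu> \<sigma> x * \<bar>\<mu>\<bar>\<bar> \<le> normal_density \<mu> \<sigma> x * \<bar>x - \<mu>\<bar>"
      by (simp add: right_diff_distrib)
  qed (use i0 i1 i2 in auto)
  finally show "\<bar>(\<integral>x. normal_density \<mu> \<sigma> x * \<bar>x\<bar> \<partial>lborel) - \<bar>\<mu>\<bar>\<bar> \<le> \<sigma> * sqrt (2 / pi)"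
    by (simp add: dev)
qed

text \<open>
  Up to normalisation, \<open>exp (- n * G)\<close> is the mixture of the normal densities centred at the values
  of \<open>S\<^sub>n / n\<close>, with the Gibbs weights as mixing weights. Each component contributes an error of
  at most its mean absolute deviation, \<open>\<sigma> * sqrt (2 / pi)\<close>.
\<close>
lemma mean_abs_spin_near_free_energy_moment:
  assumes pos: "n \<ge> 1" "\<beta> > 0" "K > 0"
  shows "\<bar>(\<integral>x. \<bar>x\<bar> * exp (- real n * free_energy \<beta> K x) \<partial>lborel) /
           (\<integral>x. exp (- real n * free_energy \<beta> K x) \<partial>lborel) - mean_abs_spin n \<beta> K\<bar>
         \<le> 1 / sqrt (pi * real n * (\<beta> * K))"
proof -
  define \<sigma> where "\<sigma> = sqrt (1 / (2 * real n * (\<beta> * K)))"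
  \<comment> \<open>turns \<open>exp (- n * G)\<close> into the mixture whose total mass is the partition function\<close>
  define A where "A = (1 + 2 * exp (- \<beta>)) ^ n * (1 / sqrt (2 * pi * \<sigma>\<^sup>2))"
  define w where "w \<equiv> \<lambda>\<omega>. exp (- \<beta> * hamiltonian n K \<omega>)"
  define m where "m \<equiv> \<lambda>\<omega>. total_spin n \<omega> / real n"
  define Z where "Z = partition_fn n \<beta> K"
  have \<sigma>2: "\<sigma>\<^sup>2 = 1 / (2 * real n * (\<beta> * K))" and \<sigma>: "\<sigma> > 0"
    using pos by (simp_all add: \<sigma>_def)
  have A: "A > 0" using \<sigma> by (auto simp: A_def intro!: mult_pos_pos zero_less_power add_pos_pos divide_pos_pos)
  have Z: "Z > 0" unfolding Z_def by (rule partition_fn_pos)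
  have w: "w \<omega> \<ge> 0" for \<omega> by (simp add: w_def)
  have Zw: "Z = (\<Sum>\<omega>\<in>configs n. w \<omega>)" by (simp add: Z_def partition_fn_def w_def)
  have mix: "A * exp (- real n * free_energy \<beta> K x) = (\<Sum>\<omega>\<in>configs n. w \<omega> * normal_density (m \<omega>) \<sigma> x)" for x
  proof -
    have nd: "normal_density (m \<omega>) \<sigma> x = 1 / sqrt (2 * pi * \<sigma>\<^sup>2) * exp (- real n * (\<beta> * K) * (x - m \<omega>)\<^sup>2)" for \<omega>
      unfolding normal_density_def \<sigma>2 using pos by (simp add: field_simps)
    have "A * exp (- real n * free_energy \<beta> K x) = 1 / sqrt (2 * pi * \<sigma>\<^sup>2) *
        ((1 + 2 * exp (- \<beta>)) ^ n * exp (- real n * free_energy \<beta> K x))"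
      by (simp only: A_def mult_ac)
    also have "\<dots> = (\<Sum>\<omega>\<in>configs n. w \<omega> * normal_density (m \<omega>) \<sigma> x)"
      unfolding nd unfolding hubbard_stratonovich[OF pos(1)] sum_distrib_left w_def m_def
      by (intro sum.cong refl) (simp only: mult_ac)
    finally show ?thesis .
  qed
  have J0: "A * (\<integral>x. exp (- real n * free_energy \<beta> K x) \<partial>lborel) = Z"
  proof -
    have "A * (\<integral>x. exp (- real n * free_energy \<beta> K x) \<partial>lborel)
        = (\<integral>x. (\<Sum>\<omega>\<in>configs n. w \<omega> * normal_density (m \<omega>) \<sigma> x) \<partial>lborel)"
      unfolding mix[symmetric] by simp
    also have "\<dots> = (\<Sum>\<omega>\<in>configs n. w \<omega>)"
      using \<sigma> by (subst Bochner_Integration.integral_sum) auto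
    finally show ?thesis by (simp add: Zw)
  qed
  have J1: "A * (\<integral>x. \<bar>x\<bar> * exp (- real n * free_energy \<beta> K x) \<partial>lborel)
      = (\<Sum>\<omega>\<in>configs n. w \<omega> * (\<integral>x. normal_density (m \<omega>) \<sigma> x * \<bar>x\<bar> \<partial>lborel))"
  proof -
    have "A * (\<integral>x. \<bar>x\<bar> * exp (- real n * free_energy \<beta> K x) \<partial>lborel)
        = (\<integral>x. (\<Sum>\<omega>\<in>configs n. w \<omega> * (normal_density (m \<omega>) \<sigma> x * \<bar>x\<bar>)) \<partial>lborel)"
    proof -
      have "(\<Sum>\<omega>\<in>configs n. w \<omega> * (normal_density (m \<omega>) \<sigma> x * \<bar>x\<bar>))
          = A * (\<bar>x\<bar> * exp (- real n * free_energy \<beta> K x))" for x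
        using arg_cong[OF mix, of "\<lambda>v. v * \<bar>x\<bar>" x] unfolding sum_distrib_right by (simp only: mult_ac)
      then show ?thesis by simp
    qed
    also have "\<dots> = (\<Sum>\<omega>\<in>configs n. w \<omega> * (\<integral>x. normal_density (m \<omega>) \<sigma> x * \<bar>x\<bar> \<partial>lborel))"
      using normal_abs_moment_near_abs_mean(1)[OF \<sigma>]
      by (subst Bochner_Integration.integral_sum) auto
    finally show ?thesis .
  qed
  have E: "Z * mean_abs_spin n \<beta> K = (\<Sum>\<omega>\<in>configs n. w \<omega> * \<bar>m \<omega>\<bar>)"
  proof -
    have "mean_abs_spin n \<beta> K = (\<Sum>\<omega>\<in>configs n. (w \<omega> / Z) * \<bar>m \<omega>\<bar>)"
      unfolding mean_abs_spin_def blume_capel_def w_def Z_def m_def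
      using partition_fn_pos[of n \<beta> K]
      by (subst lebesgue_integral_point_measure_finite) (auto simp: finite_configs less_imp_le)
    then show ?thesis using Z by (simp add: sum_distrib_left)
  qed
  let ?I = "\<lambda>\<omega>. \<integral>x. normal_density (m \<omega>) \<sigma> x * \<bar>x\<bar> \<partial>lborel"
  have ratio: "(\<integral>x. \<bar>x\<bar> * exp (- real n * free_energy \<beta> K x) \<partial>lborel) /
       (\<integral>x. exp (- real n * free_energy \<beta> K x) \<partial>lborel) = (\<Sum>\<omega>\<in>configs n. w \<omega> * ?I \<omega>) / Z"
    unfolding J0[symmetric] J1[symmetric] using A by simp
  have mean: "mean_abs_spin n \<beta> K = (\<Sum>\<omega>\<in>configs n. w \<omega> * \<bar>m \<omega>\<bar>) / Z"
    unfolding E[symmetric] using Z by simp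
  have "\<bar>(\<Sum>\<omega>\<in>configs n. w \<omega> * ?I \<omega>) - (\<Sum>\<omega>\<in>configs n. w \<omega> * \<bar>m \<omega>\<bar>)\<bar>
      \<le> (\<Sum>\<omega>\<in>configs n. w \<omega> * \<bar>?I \<omega> - \<bar>m \<omega>\<bar>\<bar>)"
    unfolding sum_subtractf[symmetric] right_diff_distrib[symmetric]
    by (rule order_trans[OF sum_abs]) (simp add: abs_mult w)
  also have "\<dots> \<le> (\<Sum>\<omega>\<in>configs n. w \<omega> * (\<sigma> * sqrt (2 / pi)))"
    using w normal_abs_moment_near_abs_mean(2)[OF \<sigma>] by (intro sum_mono mult_left_mono) auto
  also have "\<dots> = Z * (\<sigma> * sqrt (2 / pi))" by (simp add: Zw sum_distrib_right)
  also have "\<sigma> * sqrt (2 / pi) = 1 / sqrt (pi * real n * (\<beta> * K))"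
    unfolding \<sigma>_def real_sqrt_mult[symmetric] by (simp add: real_sqrt_divide real_sqrt_mult mult_ac)
  finally show ?thesis
    unfolding ratio mean diff_divide_distrib[symmetric] abs_divide using Z
    by (simp add: pos_divide_le_eq mult.commute)
qed

section \<open>Scaling limit of the mean absolute spin\<close>

lemma integrable_gaussian_abs_power:
  fixes c :: real
  assumes "c > 0"
  shows "integrable lborel (\<lambda>y. \<bar>y\<bar> ^ k * exp (- c * y\<^sup>2))"
proof -
  define \<sigma> where "\<sigma> = sqrt (1 / (2 * c))"
  have \<sigma>: "\<sigma> > 0" "\<sigma>\<^sup>2 = 1 / (2 * c)" using assms by (simp_all add: \<sigma>_def)
  have "integrable lborel (\<lambda>y. sqrt (2 * pi * \<sigma>\<^sup>2) * (normal_density 0 \<sigma> y * \<bar>y - 0\<bar> ^ k))"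
    by (intro integrable_mult_right integrable_normal_moment_abs \<sigma>)
  moreover have "(\<lambda>y. sqrt (2 * pi * \<sigma>\<^sup>2) * (normal_density 0 \<sigma> y * \<bar>y - 0\<bar> ^ k)) = (\<lambda>y. \<bar>y\<bar> ^ k * exp (- c * y\<^sup>2))"
    using assms \<sigma>(1) by (simp add: normal_density_def \<sigma>(2) fun_eq_iff)
  ultimately show ?thesis by (simp only:)
qed

text \<open>
  The dominating function is a Gaussian whose constant \<open>exp (C + c * Y\<^sup>2)\<close> is large enough to cover
  the range \<open>\<bar>y\<bar> < Y\<close> as well.
\<close>
lemma gibbs_integrals_tendsto:
  fixes f :: "nat \<Rightarrow> real \<Rightarrow> real" and F :: "real \<Rightarrow> real"
  assumes meas [measurable]: "\<And>n. f n \<in> borel_measurable borel" "F \<in> borel_measurable borel"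
    and lim: "\<And>y. (\<lambda>n. f n y) \<longlonglongrightarrow> F y"
    and c: "c > 0"
    and growth: "\<forall>\<^sub>F n in sequentially. \<forall>y. Y \<le> \<bar>y\<bar> \<longrightarrow> c * y\<^sup>2 \<le> f n y"
    and lower: "\<forall>\<^sub>F n in sequentially. \<forall>y. \<bar>y\<bar> < Y \<longrightarrow> - C \<le> f n y" and C: "C \<ge> 0"
  shows "(\<lambda>n. \<integral>y. \<bar>y\<bar> ^ k * exp (- f n y) \<partial>lborel) \<longlonglongrightarrow> (\<integral>y. \<bar>y\<bar> ^ k * exp (- F y) \<partial>lborel)"
    and "0 < (\<integral>y. \<bar>y\<bar> ^ k * exp (- F y) \<partial>lborel)"
proof -
  define w where "w \<equiv> \<lambda>y::real. exp (C + c * Y\<^sup>2) * (\<bar>y\<bar> ^ k * exp (- c * y\<^sup>2))"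
  have "\<forall>\<^sub>F n in sequentially. \<forall>y. norm (\<bar>y\<bar> ^ k * exp (- f n y)) \<le> w y"
    using growth lower
  proof eventually_elim
    case (elim n)
    show ?case
    proof
      fix y
      have "- f n y \<le> C + c * Y\<^sup>2 - c * y\<^sup>2"
      proof (cases "Y \<le> \<bar>y\<bar>")
        case True
        then have "c * y\<^sup>2 \<le> f n y" using elim by blast
        moreover have "0 \<le> c * Y\<^sup>2" using c by simp
        ultimately show ?thesis using C by linarith
      next
        case False
        then have "y\<^sup>2 \<le> Y\<^sup>2" by (intro abs_le_square_iff[THEN iffD1]) auto
        then have "c * y\<^sup>2 \<le> c * Y\<^sup>2" using c by simp
        then show ?thesis using elim False by (smt (verit))
      qed
      then have "exp (- f n y) \<le> exp (C + c * Y\<^sup>2) * exp (- c * y\<^sup>2)"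
        by (simp flip: exp_add)
      from mult_left_mono[OF this, of "\<bar>y\<bar> ^ k"] show "norm (\<bar>y\<bar> ^ k * exp (- f n y)) \<le> w y"
        by (simp add: w_def mult_ac)
    qed
  qed
  then obtain N where N: "\<And>n y. n \<ge> N \<Longrightarrow> norm (\<bar>y\<bar> ^ k * exp (- f n y)) \<le> w y"
    by (auto simp: eventually_sequentially)
  have w: "integrable lborel w"
    unfolding w_def by (intro integrable_mult_right integrable_gaussian_abs_power c)
  have ptw: "AE y in lborel. (\<lambda>n. \<bar>y\<bar> ^ k * exp (- f (n + N) y)) \<longlonglongrightarrow> \<bar>y\<bar> ^ k * exp (- F y)"
    by (intro AE_I2 tendsto_intros lim[THEN LIMSEQ_ignore_initial_segment])
  have bd: "AE y in lborel. norm (\<bar>y\<bar> ^ k * exp (- f (n + N) y)) \<le> w y" for n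
    using N[of "n + N"] by simp
  have "(\<lambda>n. \<integral>y. \<bar>y\<bar> ^ k * exp (- f (n + N) y) \<partial>lborel) \<longlonglongrightarrow> (\<integral>y. \<bar>y\<bar> ^ k * exp (- F y) \<partial>lborel)"
    by (rule integral_dominated_convergence[OF _ _ w ptw bd]) measurable
  then show "(\<lambda>n. \<integral>y. \<bar>y\<bar> ^ k * exp (- f n y) \<partial>lborel) \<longlonglongrightarrow> (\<integral>y. \<bar>y\<bar> ^ k * exp (- F y) \<partial>lborel)"
    by (rule LIMSEQ_offset)
  have int: "integrable lborel (\<lambda>y. \<bar>y\<bar> ^ k * exp (- F y))"
    by (rule integrable_dominated_convergence[OF _ _ w ptw bd]) measurable
  have "(\<integral>y. \<bar>y\<bar> ^ k * exp (- F y) \<partial>lborel) \<noteq> 0"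
  proof
    assume "(\<integral>y. \<bar>y\<bar> ^ k * exp (- F y) \<partial>lborel) = 0"
    then have "AE y in lborel. \<bar>y\<bar> ^ k * exp (- F y) = 0"
      using integral_nonneg_eq_0_iff_AE[OF int] by simp
    then have "AE y::real in lborel. y = 0 \<and> k > 0" by (rule eventually_mono) auto
    with AE_lborel_singleton[of "0::real"] have "AE y::real in lborel. False"
      by eventually_elim simp
    then show False by (simp add: AE_iff_measurable[where N = UNIV])
  qed
  moreover have "(\<integral>y. \<bar>y\<bar> ^ k * exp (- F y) \<partial>lborel) \<ge> 0" by simp
  ultimately show "0 < (\<integral>y. \<bar>y\<bar> ^ k * exp (- F y) \<partial>lborel)" by linarith
qed

lemma free_energy_measurable [measurable]: "free_energy \<beta> K \<in> borel_measurable borel"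
  unfolding free_energy_def[abs_def] cumulant_def by measurable

lemma coercive_poly_bounded_below:
  fixes p :: "real poly"
  assumes "filterlim (poly p) at_top at_infinity"
  obtains C where "C \<ge> 0" "\<And>x. - C \<le> poly p x"
proof -
  have "eventually (\<lambda>x. poly p x \<ge> 0) at_infinity"
    using assms by (simp add: filterlim_at_top)
  then obtain B where B: "\<And>x. norm x \<ge> B \<Longrightarrow> poly p x \<ge> 0"
    by (auto simp: eventually_at_infinity)
  have "bounded (poly p ` {- B..B})"
    by (intro compact_imp_bounded compact_continuous_image continuous_intros) auto
  then obtain C where C: "\<forall>x\<in>{- B..B}. \<bar>poly p x\<bar> \<le> C"
    by (auto simp: bounded_iff)
  have "- max C 0 \<le> poly p x" for x
  proof (cases "x \<in> {- B..B}")
    case True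
    then have "\<bar>poly p x\<bar> \<le> C" using C by blast
    then show ?thesis by linarith
  next
    case False
    then have "norm x \<ge> B" by auto
    then show ?thesis using B[of x] by linarith
  qed
  then show ?thesis using that[of "max C 0"] by simp
qed

text \<open>
  A polynomial that tends to infinity at both ends is bounded below, so the growth of the argument
  between the scales \<open>\<gamma>\<close> and \<open>\<tau>\<close> is harmless; and where the free energy is negative, lowering the
  prefactor from \<open>n powr \<delta>\<close> to \<open>n\<close> only raises the value.
\<close>
lemma eventually_rescaled_free_energy_lower:
  fixes \<beta> K :: "nat \<Rightarrow> real" and H :: "real poly"
  assumes H: "filterlim (poly H) at_top at_infinity"
    and exps: "\<gamma> > 0" "\<delta> \<ge> 1" and R: "R > 0"
    and low: "\<forall>\<^sub>F n in sequentially. \<forall>x. \<bar>x / real n powr \<tau>\<bar> < R \<longrightarrow>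
          real n powr \<delta> * free_energy (\<beta> n) (K n) (x / real n powr \<tau>) \<ge> poly H x"
  shows "\<exists>C\<ge>0. \<forall>\<^sub>F n in sequentially. \<forall>y. \<bar>y\<bar> < Y \<longrightarrow>
    - C \<le> real n * free_energy (\<beta> n) (K n) (y / real n powr \<gamma>)"
proof -
  obtain C where C: "C \<ge> 0" "\<And>x. - C \<le> poly H x"
    using coercive_poly_bounded_below[OF H] by blast
  have "filterlim (\<lambda>n. real n powr \<gamma>) at_top sequentially"
    using exps by real_asymp
  then have "\<forall>\<^sub>F n in sequentially. real n powr \<gamma> > Y / R"
    by (simp add: filterlim_at_top_dense)
  then have "\<forall>\<^sub>F n in sequentially. \<forall>y. \<bar>y\<bar> < Y \<longrightarrow> - C \<le> real n * free_energy (\<beta> n) (K n) (y / real n powr \<gamma>)"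
    using low eventually_ge_at_top[of 1]
  proof eventually_elim
    case (elim n)
    show ?case
    proof (intro allI impI)
      fix y assume y: "\<bar>y\<bar> < Y"
      define G where "G = free_energy (\<beta> n) (K n) (y / real n powr \<gamma>)"
      \<comment> \<open>the same point in units of \<open>n powr (- \<tau>)\<close>\<close>
      define x where "x = y / real n powr \<gamma> * real n powr \<tau>"
      have n: "real n \<ge> 1" using elim by simp
      have x: "x / real n powr \<tau> = y / real n powr \<gamma>" using n by (simp add: x_def)
      have "\<bar>y\<bar> < R * real n powr \<gamma>" using y elim R by (simp add: field_simps)
      then have "\<bar>x / real n powr \<tau>\<bar> < R" unfolding x using n by (simp add: abs_divide field_simps)
      then have "real n powr \<delta> * G \<ge> - C"
        using elim C(2)[of x] unfolding x[symmetric] G_def by (metis order_trans)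
      moreover have "real n * G \<ge> real n powr \<delta> * G \<or> real n * G \<ge> 0"
      proof (cases "G \<ge> 0")
        case False
        have "real n \<le> real n powr \<delta>" using powr_mono[of 1 \<delta> "real n"] n exps by simp
        then show ?thesis using False by (auto intro: mult_right_mono_neg)
      qed simp
      ultimately show "- C \<le> real n * free_energy (\<beta> n) (K n) (y / real n powr \<gamma>)"
        using C(1) unfolding G_def by linarith
    qed
  qed
  with C(1) show ?thesis by blast
qed

lemma free_energy_moment_rescale:
  assumes "b > 0"
  shows "b * ((\<integral>x. \<bar>x\<bar> * exp (- r * free_energy \<beta> K x) \<partial>lborel) / (\<integral>x. exp (- r * free_energy \<beta> K x) \<partial>lborel))
    = (\<integral>y. \<bar>y\<bar> * exp (- (r * free_energy \<beta> K (y / b))) \<partial>lborel) / (\<integral>y. exp (- (r * free_energy \<beta> K (y / b))) \<partial>lborel)"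
proof -
  have 0: "(\<integral>x. exp (- r * free_energy \<beta> K x) \<partial>lborel) = (\<integral>y. exp (- (r * free_energy \<beta> K (y / b))) \<partial>lborel) / b"
    using assms by (subst lborel_integral_real_affine[where c = "1 / b" and t = 0]) auto
  have 1: "(\<integral>x. \<bar>x\<bar> * exp (- r * free_energy \<beta> K x) \<partial>lborel)
      = (\<integral>y. \<bar>y\<bar> * exp (- (r * free_energy \<beta> K (y / b))) \<partial>lborel) / b / b"
    using assms by (subst lborel_integral_real_affine[where c = "1 / b" and t = 0]) (auto simp: abs_divide)
  show ?thesis unfolding 0 1 using assms by simp
qed

lemma mean_abs_spin_scaling_limit:
  fixes \<beta> K :: "nat \<Rightarrow> real"
  assumes lim: "\<beta> \<longlonglongrightarrow> \<beta>0" "K \<longlonglongrightarrow> K0" "\<beta>0 > 0" "K0 > 0"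
    and p: "even_coercive_4_6 p"
    and ptw: "\<And>y. (\<lambda>n. real n * free_energy (\<beta> n) (K n) (y / real n powr \<gamma>)) \<longlonglongrightarrow> poly p y"
    and lower: "\<And>Y. \<exists>C\<ge>0. \<forall>\<^sub>F n in sequentially. \<forall>y. \<bar>y\<bar> < Y \<longrightarrow>
        - C \<le> real n * free_energy (\<beta> n) (K n) (y / real n powr \<gamma>)"
    and \<gamma>: "\<gamma> < 1 / 2"
  shows "(\<lambda>n. real n powr \<gamma> * mean_abs_spin n (\<beta> n) (K n)) \<longlonglongrightarrow> gibbs_abs_moment p"
    and "gibbs_abs_moment p > 0"
proof -
  define f where "f \<equiv> \<lambda>n y. real n * free_energy (\<beta> n) (K n) (y / real n powr \<gamma>)"
  define I where "I \<equiv> \<lambda>k n. \<integral>y. \<bar>y\<bar> ^ k * exp (- f n y) \<partial>lborel"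
  define L where "L \<equiv> \<lambda>k. \<integral>y. \<bar>y\<bar> ^ k * exp (- poly p y) \<partial>lborel"
  have pos: "\<forall>\<^sub>F n in sequentially. 0 < \<beta> n \<and> 0 < K n"
    using order_tendstoD(1)[OF lim(1,3)] order_tendstoD(1)[OF lim(2,4)] by eventually_elim simp
  have "\<forall>\<^sub>F n in sequentially. \<beta> n > 0 \<and> K n > 0 \<and> real n > 0 \<and> real n powr \<gamma> > 0"
    using pos eventually_gt_at_top[of 0] by eventually_elim simp
  from eventually_quadratic_growth[OF p ptw this] obtain c Y where
    c: "c > 0" and growth: "\<forall>\<^sub>F n in sequentially. \<forall>y. Y \<le> \<bar>y\<bar> \<longrightarrow> c * y\<^sup>2 \<le> f n y"
    unfolding f_def by blast
  obtain C where C: "C \<ge> 0" "\<forall>\<^sub>F n in sequentially. \<forall>y. \<bar>y\<bar> < Y \<longrightarrow> - C \<le> f n y"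
    using lower[of Y] unfolding f_def by blast
  have meas: "f n \<in> borel_measurable borel" "poly p \<in> borel_measurable borel" for n
    unfolding f_def by (measurable, intro borel_measurable_continuous_onI continuous_intros)
  have ptw': "(\<lambda>n. f n y) \<longlonglongrightarrow> poly p y" for y unfolding f_def by (rule ptw)
  have I: "I k \<longlonglongrightarrow> L k" and L: "L k > 0" for k
    unfolding I_def L_def
    using gibbs_integrals_tendsto[OF meas ptw' c growth C(2,1), of k] by auto
  have gibbs: "gibbs_abs_moment p = L 1 / L 0" by (simp add: gibbs_abs_moment_def L_def)
  show "gibbs_abs_moment p > 0" unfolding gibbs using L[of 0] L[of 1] by simp
  have ratio: "(\<lambda>n. I 1 n / I 0 n) \<longlonglongrightarrow> gibbs_abs_moment p"
    unfolding gibbs using L[of 0] by (intro tendsto_divide I) auto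
  \<comment> \<open>the Gaussian error, of order \<open>n powr (\<gamma> - 1/2)\<close>\<close>
  have "(\<lambda>n. real n powr \<gamma> * mean_abs_spin n (\<beta> n) (K n) - I 1 n / I 0 n) \<longlonglongrightarrow> 0"
  proof (rule Lim_null_comparison)
    show "\<forall>\<^sub>F n in sequentially. norm (real n powr \<gamma> * mean_abs_spin n (\<beta> n) (K n) - I 1 n / I 0 n)
        \<le> real n powr \<gamma> / sqrt (real n) * (1 / sqrt (pi * (\<beta> n * K n)))"
      using pos eventually_ge_at_top[of 1]
    proof eventually_elim
      case (elim n)
      let ?q = "(\<integral>x. \<bar>x\<bar> * exp (- real n * free_energy (\<beta> n) (K n) x) \<partial>lborel) /
           (\<integral>x. exp (- real n * free_energy (\<beta> n) (K n) x) \<partial>lborel)"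
      have eq: "I 1 n / I 0 n = real n powr \<gamma> * ?q"
        unfolding I_def f_def using elim
        by (subst free_energy_moment_rescale) simp_all
      have "\<bar>real n powr \<gamma> * mean_abs_spin n (\<beta> n) (K n) - real n powr \<gamma> * ?q\<bar>
          = real n powr \<gamma> * \<bar>?q - mean_abs_spin n (\<beta> n) (K n)\<bar>"
        unfolding right_diff_distrib[symmetric] abs_mult by (simp add: abs_minus_commute)
      also have "\<dots> \<le> real n powr \<gamma> * (1 / sqrt (pi * real n * (\<beta> n * K n)))"
        using elim by (intro mult_left_mono mean_abs_spin_near_free_energy_moment) auto
      also have "\<dots> = real n powr \<gamma> / sqrt (real n) * (1 / sqrt (pi * (\<beta> n * K n)))"
        by (simp add: real_sqrt_mult)
      finally show ?case unfolding eq by simp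
    qed
    have 1: "(\<lambda>n. real n powr \<gamma> / sqrt (real n)) \<longlonglongrightarrow> 0" using \<gamma> by real_asymp
    have 2: "(\<lambda>n. 1 / sqrt (pi * (\<beta> n * K n))) \<longlonglongrightarrow> 1 / sqrt (pi * (\<beta>0 * K0))"
      using lim by (intro tendsto_intros) auto
    show "(\<lambda>n. real n powr \<gamma> / sqrt (real n) * (1 / sqrt (pi * (\<beta> n * K n)))) \<longlonglongrightarrow> 0"
      using tendsto_mult[OF 1 2] by simp
  qed
  from tendsto_add[OF this ratio]
  show "(\<lambda>n. real n powr \<gamma> * mean_abs_spin n (\<beta> n) (K n)) \<longlonglongrightarrow> gibbs_abs_moment p" by simp
qed

section \<open>Comparison with the thermodynamic magnetization\<close>

text \<open>
  \<open>radial_slope\<close> vanishes at two positive minimum points, and it is strictly decreasing before or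
  strictly increasing after any point between them. Hence it is negative between them, and the
  free energy would strictly decrease from one minimum point to the other.
\<close>
lemma positive_minimizer_unique:
  assumes "\<beta> > 0" "K > 0"
    and x: "0 < x" "x \<in> equil_macrostates \<beta> K" and y: "0 < y" "y \<in> equil_macrostates \<beta> K"
  shows "x = y"
proof -
  have *: False if "0 < x" "x < y" and m: "x \<in> equil_macrostates \<beta> K" "y \<in> equil_macrostates \<beta> K" for x y
  proof -
    have slope0: "radial_slope \<beta> K z = 0" if "z > 0" "z \<in> equil_macrostates \<beta> K" for z
    proof -
      have "z * radial_slope \<beta> K z = 0"
        by (rule DERIV_local_min[OF free_energy_deriv, of z 1]) (use that in \<open>auto simp: global_min_points_def\<close>)
      then show ?thesis using that by simp
    qed
    have neg: "radial_slope \<beta> K z < 0" if "x < z" "z < y" for z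
      using radial_slope_dichotomy[OF assms(1,2), of z] slope0[of x] slope0[of y] that \<open>0 < x\<close> m
      by (smt (verit))
    have "free_energy \<beta> K y < free_energy \<beta> K x"
    proof (rule DERIV_neg_imp_decreasing_open[OF \<open>x < y\<close>])
      fix z assume z: "x < z" "z < y"
      then show "\<exists>d. (free_energy \<beta> K has_real_derivative d) (at z) \<and> d < 0"
        using \<open>0 < x\<close> neg[OF z] free_energy_deriv[of z \<beta> K] mult_pos_neg[of z "radial_slope \<beta> K z"]
        by fastforce
    next
      show "continuous_on {x..y} (free_energy \<beta> K)"
        using \<open>0 < x\<close> by (intro continuous_at_imp_continuous_on ballI DERIV_isCont[OF free_energy_deriv]) auto
    qed
    then show False using m by (auto simp: global_min_points_def not_le[symmetric])
  qed
  show ?thesis using *[of x y] *[of y x] x y by (meson linorder_neqE_linordered_idom)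
qed

lemma magnetization_is_minimizer:
  assumes "(\<beta>, K) \<in> phase_coexistence"
  shows "0 < magnetization \<beta> K" "magnetization \<beta> K \<in> equil_macrostates \<beta> K"
proof -
  have pos: "\<beta> > 0" "K > 0" using assms by (auto simp: phase_coexistence_def)
  obtain x where x: "x \<in> equil_macrostates \<beta> K" "x \<noteq> 0"
    using assms by (auto simp: phase_coexistence_def)
  then have "0 < \<bar>x\<bar> \<and> \<bar>x\<bar> \<in> equil_macrostates \<beta> K"
    by (simp add: global_min_points_def)
  then have "\<exists>!x. 0 < x \<and> x \<in> equil_macrostates \<beta> K"
    using positive_minimizer_unique[OF pos] by blast
  from theI'[OF this] show "0 < magnetization \<beta> K" "magnetization \<beta> K \<in> equil_macrostates \<beta> K"
    by (simp_all add: magnetization_def)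
qed

text \<open>
  The free energy at its minimum point is at most its value 0 at the origin, while beyond \<open>Y\<close> the
  rescaled free energy is positive.
\<close>
lemma eventually_magnetization_le:
  fixes \<beta> K a b :: "nat \<Rightarrow> real"
  assumes p: "even_coercive_4_6 p"
    and lim: "\<And>y. (\<lambda>n. a n * free_energy (\<beta> n) (K n) (y / b n)) \<longlonglongrightarrow> poly p y"
    and pos: "\<forall>\<^sub>F n in sequentially. a n > 0 \<and> b n > 0"
    and coex: "\<forall>\<^sub>F n in sequentially. (\<beta> n, K n) \<in> phase_coexistence"
  obtains Y where "Y > 0" "\<forall>\<^sub>F n in sequentially. magnetization (\<beta> n) (K n) \<le> Y / b n"
proof -
  have "\<forall>\<^sub>F n in sequentially. \<beta> n > 0 \<and> K n > 0 \<and> a n > 0 \<and> b n > 0"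
    using pos coex by eventually_elim (auto simp: phase_coexistence_def)
  from eventually_quadratic_growth[OF p lim this] obtain c Y where cY: "c > 0" "Y > 0"
    "\<forall>\<^sub>F n in sequentially. \<forall>y. Y \<le> \<bar>y\<bar> \<longrightarrow> c * y\<^sup>2 \<le> a n * free_energy (\<beta> n) (K n) (y / b n)"
    by blast
  have "\<forall>\<^sub>F n in sequentially. magnetization (\<beta> n) (K n) \<le> Y / b n"
    using pos coex cY(3)
  proof eventually_elim
    case (elim n)
    define m where "m = magnetization (\<beta> n) (K n)"
    have m: "0 < m" "m \<in> equil_macrostates (\<beta> n) (K n)"
      unfolding m_def using magnetization_is_minimizer elim by auto
    have "free_energy (\<beta> n) (K n) m \<le> free_energy (\<beta> n) (K n) 0"
      using m(2) unfolding global_min_points_def by blast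
    then have "a n * free_energy (\<beta> n) (K n) (m * b n / b n) \<le> 0"
      using elim by (simp add: mult_nonneg_nonpos)
    moreover have "0 < c * (m * b n)\<^sup>2" using m elim cY by simp
    ultimately have "\<not> Y \<le> \<bar>m * b n\<bar>" using elim by (meson order.trans not_le)
    then have "m * b n < Y" by simp
    then show ?case using elim by (simp add: m_def field_simps)
  qed
  with cY(2) show ?thesis by (rule that)
qed

theorem theorem4p2:
  fixes \<beta> \<alpha>\<^sub>0 \<theta> :: real
    and \<beta>s Ks :: "real \<Rightarrow> nat \<Rightarrow> real"
    and g gt H :: "real poly"
  assumes beta: "0 < \<beta>" "\<beta> \<le> beta_crit"
    and seq_pos: "\<forall>\<alpha>>0. \<forall>n\<ge>1. 0 < \<beta>s \<alpha> n \<and> 0 < Ks \<alpha> n"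
    and seq_lim: "\<forall>\<alpha>>0. (\<lambda>n. (\<beta>s \<alpha> n, Ks \<alpha> n)) \<longlonglongrightarrow> (\<beta>, K_crit \<beta>)"
    and hyp_i: "\<forall>\<alpha>>0. \<forall>\<^sub>F n in sequentially. (\<beta>s \<alpha> n, Ks \<alpha> n) \<in> phase_coexistence"
    and hyp_ii: "\<forall>\<alpha>>0. \<exists>b k.
        (\<lambda>n. real n powr \<alpha> * (\<beta>s \<alpha> n - \<beta>)) \<longlonglongrightarrow> b \<and>
        (\<lambda>n. real n powr \<alpha> * (Ks \<alpha> n - K_crit \<beta>)) \<longlonglongrightarrow> k \<and>
        \<not> (b = 0 \<and> k = 0) \<and> (b \<noteq> 0 \<longrightarrow> b \<in> {1, -1})"
    and g: "even_coercive_4_6 g"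
    and alpha0: "0 < \<alpha>\<^sub>0" and theta: "0 < \<theta>"
    and hyp_iii_a: "\<forall>\<alpha>>\<alpha>\<^sub>0. \<forall>C. compact C \<longrightarrow>
        uniform_limit C
          (\<lambda>n x. real n powr (\<alpha> / \<alpha>\<^sub>0) *
                 free_energy (\<beta>s \<alpha> n) (Ks \<alpha> n) (x / real n powr (\<theta> * \<alpha>)))
          (poly g) sequentially"
    and hyp_iii_b: "\<exists>!x. 0 < x \<and> x \<in> global_min_points (poly g)"
    and H: "filterlim (poly H) at_top at_infinity"
    and hyp_iv: "\<forall>\<alpha>\<ge>\<alpha>\<^sub>0. \<exists>R>0. \<forall>\<^sub>F n in sequentially.
        \<forall>x. \<bar>x / real n powr (\<theta> * \<alpha>)\<bar> < R \<longrightarrow>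
          real n powr (\<alpha> / \<alpha>\<^sub>0) *
            free_energy (\<beta>s \<alpha> n) (Ks \<alpha> n) (x / real n powr (\<theta> * \<alpha>)) \<ge> poly H x"
    and gt: "even_coercive_4_6 gt"
    and hyp_v: "\<forall>\<alpha>>\<alpha>\<^sub>0. \<forall>x.
        (\<lambda>n. real n * free_energy (\<beta>s \<alpha> n) (Ks \<alpha> n) (x / real n powr (\<theta> * \<alpha>\<^sub>0)))
          \<longlonglongrightarrow> poly gt x"
    and exponent: "0 < \<theta> * \<alpha>\<^sub>0" "\<theta> * \<alpha>\<^sub>0 < 1 / 2"
  shows "(\<forall>\<alpha>>\<alpha>\<^sub>0.
            (\<lambda>n. mean_abs_spin n (\<beta>s \<alpha> n) (Ks \<alpha> n)) \<sim>[sequentially]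
              (\<lambda>n. gibbs_abs_moment gt / real n powr (\<theta> * \<alpha>\<^sub>0)) \<and>
            (\<lambda>n. real n powr (\<theta> * \<alpha>\<^sub>0) * mean_abs_spin n (\<beta>s \<alpha> n) (Ks \<alpha> n))
              \<longlonglongrightarrow> gibbs_abs_moment gt) \<and>
         (\<forall>\<alpha>>\<alpha>\<^sub>0.
            filterlim
              (\<lambda>n. mean_abs_spin n (\<beta>s \<alpha> n) (Ks \<alpha> n) / magnetization (\<beta>s \<alpha> n) (Ks \<alpha> n))
              at_top sequentially)"
proof -
  have main: "(\<lambda>n. real n powr (\<theta> * \<alpha>\<^sub>0) * mean_abs_spin n (\<beta>s \<alpha> n) (Ks \<alpha> n)) \<longlonglongrightarrow> gibbs_abs_moment gt"
    "gibbs_abs_moment gt > 0" if \<alpha>: "\<alpha> > \<alpha>\<^sub>0" for \<alpha>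
  proof -
    have \<alpha>0: "\<alpha> > 0" using \<alpha> alpha0 by simp
    have Kc: "K_crit \<beta> > 0" using beta by (simp add: K_crit_def add_pos_pos)
    obtain R where R: "R > 0" "\<forall>\<^sub>F n in sequentially. \<forall>x. \<bar>x / real n powr (\<theta> * \<alpha>)\<bar> < R \<longrightarrow>
          real n powr (\<alpha> / \<alpha>\<^sub>0) * free_energy (\<beta>s \<alpha> n) (Ks \<alpha> n) (x / real n powr (\<theta> * \<alpha>)) \<ge> poly H x"
      using spec[OF hyp_iv, of \<alpha>] \<alpha> by auto
    have "\<alpha> / \<alpha>\<^sub>0 \<ge> 1" using \<alpha> alpha0 by simp
    note lower = eventually_rescaled_free_energy_lower[OF H exponent(1) this R]
    have lims: "\<beta>s \<alpha> \<longlonglongrightarrow> \<beta>" "Ks \<alpha> \<longlonglongrightarrow> K_crit \<beta>"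
      using tendsto_fst[OF seq_lim[rule_format, OF \<alpha>0]] tendsto_snd[OF seq_lim[rule_format, OF \<alpha>0]] by simp_all
    note * = mean_abs_spin_scaling_limit[OF lims beta(1) Kc gt hyp_v[rule_format, OF \<alpha>] lower exponent(2)]
    show "(\<lambda>n. real n powr (\<theta> * \<alpha>\<^sub>0) * mean_abs_spin n (\<beta>s \<alpha> n) (Ks \<alpha> n)) \<longlonglongrightarrow> gibbs_abs_moment gt"
      "gibbs_abs_moment gt > 0"
      by (rule *(1), rule *(2))
  qed
  have "(\<lambda>n. mean_abs_spin n (\<beta>s \<alpha> n) (Ks \<alpha> n)) \<sim>[sequentially]
      (\<lambda>n. gibbs_abs_moment gt / real n powr (\<theta> * \<alpha>\<^sub>0))" if \<alpha>: "\<alpha> > \<alpha>\<^sub>0" for \<alpha>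
  proof (rule asymp_equivI')
    have "(\<lambda>n. real n powr (\<theta> * \<alpha>\<^sub>0) * mean_abs_spin n (\<beta>s \<alpha> n) (Ks \<alpha> n) / gibbs_abs_moment gt)
        \<longlonglongrightarrow> gibbs_abs_moment gt / gibbs_abs_moment gt"
      using main[OF \<alpha>] by (intro tendsto_divide tendsto_const) auto
    then show "(\<lambda>n. mean_abs_spin n (\<beta>s \<alpha> n) (Ks \<alpha> n) / (gibbs_abs_moment gt / real n powr (\<theta> * \<alpha>\<^sub>0))) \<longlonglongrightarrow> 1"
      using main(2)[OF \<alpha>] by (simp add: mult_ac)
  qed
  moreover have "filterlim
      (\<lambda>n. mean_abs_spin n (\<beta>s \<alpha> n) (Ks \<alpha> n) / magnetization (\<beta>s \<alpha> n) (Ks \<alpha> n))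
      at_top sequentially" if \<alpha>: "\<alpha> > \<alpha>\<^sub>0" for \<alpha>
  proof -
    have coex: "\<forall>\<^sub>F n in sequentially. (\<beta>s \<alpha> n, Ks \<alpha> n) \<in> phase_coexistence"
      using hyp_i \<alpha> alpha0 by simp
    have ptw: "(\<lambda>n. real n powr (\<alpha> / \<alpha>\<^sub>0) * free_energy (\<beta>s \<alpha> n) (Ks \<alpha> n) (y / real n powr (\<theta> * \<alpha>)))
        \<longlonglongrightarrow> poly g y" for y
      using tendsto_uniform_limitI[OF hyp_iii_a[rule_format, OF \<alpha>, of "{y}"]] by simp
    have "\<forall>\<^sub>F n in sequentially. real n powr (\<alpha> / \<alpha>\<^sub>0) > 0 \<and> real n powr (\<theta> * \<alpha>) > 0"
      using eventually_gt_at_top[of 0] by eventually_elim simp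
    from eventually_magnetization_le[OF g ptw this coex] obtain Y where
      Y: "Y > 0" "\<forall>\<^sub>F n in sequentially. magnetization (\<beta>s \<alpha> n) (Ks \<alpha> n) \<le> Y / real n powr (\<theta> * \<alpha>)" by blast
    have "\<theta> * \<alpha> > \<theta> * \<alpha>\<^sub>0" using \<alpha> theta by simp
    then have "filterlim (\<lambda>n. real n powr (\<theta> * \<alpha> - \<theta> * \<alpha>\<^sub>0) / Y) at_top sequentially"
      using Y(1) by real_asymp
    from filterlim_tendsto_pos_mult_at_top[OF main[OF \<alpha>] this]
    show ?thesis
    proof (rule filterlim_at_top_mono)
      show "\<forall>\<^sub>F n in sequentially. real n powr (\<theta> * \<alpha>\<^sub>0) * mean_abs_spin n (\<beta>s \<alpha> n) (Ks \<alpha> n) *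
            (real n powr (\<theta> * \<alpha> - \<theta> * \<alpha>\<^sub>0) / Y)
          \<le> mean_abs_spin n (\<beta>s \<alpha> n) (Ks \<alpha> n) / magnetization (\<beta>s \<alpha> n) (Ks \<alpha> n)"
        using coex Y(2) eventually_gt_at_top[of 0]
      proof eventually_elim
        case (elim n)
        define m where "m = magnetization (\<beta>s \<alpha> n) (Ks \<alpha> n)"
        define e where "e = mean_abs_spin n (\<beta>s \<alpha> n) (Ks \<alpha> n)"
        have m: "m > 0" unfolding m_def using elim by (intro magnetization_is_minimizer)
        have e: "e \<ge> 0" unfolding e_def mean_abs_spin_def by simp
        have "real n powr (\<theta> * \<alpha>) / Y \<le> 1 / m"
          using elim m Y(1) unfolding m_def[symmetric] by (simp add: field_simps)
        then have "e * (real n powr (\<theta> * \<alpha>) / Y) \<le> e * (1 / m)" using e by (rule mult_left_mono)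
        then show ?case
          using elim unfolding m_def[symmetric] e_def[symmetric] by (simp add: powr_diff mult_ac)
      qed
    qed
  qed
  ultimately show ?thesis using main(1) by blast
qed

end
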